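(* Let $n\ge2$ and let $\xi\in\mathcal F_n^2$ be an isometric scalar symbol. Then the following are equivalent: (1) $W_\xi$ is Fredholm; (2) $I-W_\xi W_\xi^*$ is compact; (3) $\xi$ is a finite Blaschke symbol. If these conditions hold and $\xi$ has degree $d$, then $\operatorname{ind}(W_\xi)=-d$.
   Context: Full Fock space: $\mathcal F_n^2=\mathbb C\Omega\oplus\bigoplus_{m\ge1}(\mathbb C^n)^{\otimes m}$, with canonical orthonormal basis $\{e_\mu:\mu\in\mathbb F_n^+\}$, where $\mathbb F_n^+$ is the free monoid on letters $1,\dots,n$ with identity $\varnothing$, $e_\varnothing=\Omega$, and $e_{\mu_1\cdots\mu_m}=e_{\mu_1}\otimes\cdots\otimes e_{\mu_m}$. The left creation operators are the isometries $S_ie_\mu=e_{i\mu}$. Scalar odometer map: for $\xi\in\mathcal F_n^2$, $W_\xi$ is the operator on $\mathcal F_n^2$ determined by $W_\xi\Omega=\xi$ and, for a nonempty word $\mu=\mu_1\cdots\mu_m$: if $\mu\ne n^m$ (not all letters equal $n$) and $r=\min\{j:\mu_j\neq n\}$, then $W_\xi e_\mu=e_1^{\otimes(r-1)}\otimes e_{\mu_r+1}\otimes e_{\mu_{r+1}}\otimes\cdots\otimes e_{\mu_m}$; if $\mu=n^m$, then $W_\xi e_{n^m}=e_1^{\otimes m}\otimes\xi=S_1^m\xi$. The vector $\xi$ is an isometric scalar symbol if $W_\xi$ is an isometry (i.e. this prescription extends to an isometry of $\mathcal F_n^2$). Let $\mathcal M^\perp=\overline{\operatorname{span}}\{e_1^{\otimes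 p}:p\ge0\}$ (with $e_1^{\otimes 0}=\Omega$) and let $U_1:\mathcal M^\perp\to H^2(\mathbb D)$ be the unitary $U_1(e_1^{\otimes p})=z^p$. Known fact: $W_\xi$ is an isometry if and only if $\xi\in\mathcal M^\perp$ and $\Theta_\xi:=U_1\xi$ is an inner function. An isometric scalar symbol $\xi$ is a finite Blaschke symbol of degree $d\ge0$ if $\Theta_\xi(z)=\lambda\prod_{j=1}^d\frac{z-a_j}{1-\overline{a_j}z}$ with $\lambda\in\mathbb T$, $a_1,\dots,a_d\in\mathbb D$ (for $d=0$, a unimodular constant). Index convention: $\operatorname{ind}(T)=\dim\ker T-\dim\ker T^*$. *)

theory Defs
  imports "HOL-Analysis.Analysis"
begin

section \<open>The complex Hilbert space of square-summable families\<close>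

typedef 'a ell2 = "{f :: 'a \<Rightarrow> complex. (\<lambda>i. (cmod (f i))\<^sup>2) summable_on UNIV}"
  morphisms coord Abs_ell2
  by (rule exI[of _ "\<lambda>_. 0"]) simp

setup_lifting type_definition_ell2

lemma coord_summable: "(\<lambda>i. (cmod (coord x i))\<^sup>2) summable_on UNIV"
  using coord[of x] by simp

lemma ell2_eqI: "(\<And>i. coord x i = coord y i) \<Longrightarrow> x = y"
  by (metis coord_inject ext)

lemma square_summable_add:
  fixes f g :: "'a \<Rightarrow> complex"
  assumes "(\<lambda>i. (cmod (f i))\<^sup>2) summable_on UNIV" "(\<lambda>i. (cmod (g i))\<^sup>2) summable_on UNIV"
  shows "(\<lambda>i. (cmod (f i + g i))\<^sup>2) summable_on UNIV"
proof (rule summable_on_comparison_test)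
  show "(\<lambda>i. 2 * (cmod (f i))\<^sup>2 + 2 * (cmod (g i))\<^sup>2) summable_on UNIV"
    by (intro summable_on_add summable_on_cmult_right assms)
  fix i
  have "(cmod (f i + g i))\<^sup>2 \<le> (cmod (f i) + cmod (g i))\<^sup>2"
    by (intro power_mono norm_triangle_ineq norm_ge_zero)
  also have "\<dots> \<le> 2 * (cmod (f i))\<^sup>2 + 2 * (cmod (g i))\<^sup>2"
    using sum_squares_bound[of "cmod (f i)" "cmod (g i)"] by (simp add: power2_sum)
  finally show "(cmod (f i + g i))\<^sup>2 \<le> 2 * (cmod (f i))\<^sup>2 + 2 * (cmod (g i))\<^sup>2" .
qed simp

lemma square_summable_mult:
  fixes f :: "'a \<Rightarrow> complex"
  assumes "(\<lambda>i. (cmod (f i))\<^sup>2) summable_on UNIV"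
  shows "(\<lambda>i. (cmod (c * f i))\<^sup>2) summable_on UNIV"
  using summable_on_cmult_right[OF assms, of "(cmod c)\<^sup>2"]
  by (simp add: norm_mult power_mult_distrib)

lift_definition scaleC :: "complex \<Rightarrow> 'a ell2 \<Rightarrow> 'a ell2" (infixr "*\<^sub>C" 75)
  is "\<lambda>c f i. c * f i"
  by (rule square_summable_mult)

text \<open>Linear in the first argument and conjugate-linear in the second.\<close>

definition cinner :: "'a ell2 \<Rightarrow> 'a ell2 \<Rightarrow> complex" where
  "cinner x y = (\<Sum>\<^sub>\<infinity>i. coord x i * cnj (coord y i))"

lemma cinner_summable: "(\<lambda>i. coord x i * cnj (coord y i)) summable_on UNIV"
proof (rule abs_summable_summable, rule Infinite_Sum.abs_summable_on_comparison_test')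
  show "(\<lambda>i. (cmod (coord x i))\<^sup>2 + (cmod (coord y i))\<^sup>2) summable_on UNIV"
    by (intro summable_on_add coord_summable)
  fix i
  have "2 * cmod (coord x i) * cmod (coord y i) \<le> (cmod (coord x i))\<^sup>2 + (cmod (coord y i))\<^sup>2"
    by (rule sum_squares_bound)
  moreover have "0 \<le> cmod (coord x i) * cmod (coord y i)" by simp
  ultimately show "norm (coord x i * cnj (coord y i)) \<le> (cmod (coord x i))\<^sup>2 + (cmod (coord y i))\<^sup>2"
    unfolding norm_mult complex_mod_cnj by linarith
qed

instantiation ell2 :: (type) real_inner
begin

lift_definition zero_ell2 :: "'a ell2" is "\<lambda>_. 0" by simp

lift_definition plus_ell2 :: "'a ell2 \<Rightarrow> 'a ell2 \<Rightarrow> 'a ell2" is "\<lambda>f g i. f i + g i"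
  by (rule square_summable_add)

lift_definition uminus_ell2 :: "'a ell2 \<Rightarrow> 'a ell2" is "\<lambda>f i. - f i" by simp

definition minus_ell2 :: "'a ell2 \<Rightarrow> 'a ell2 \<Rightarrow> 'a ell2" where
  "x - y = x + - (y :: 'a ell2)"

definition scaleR_ell2 :: "real \<Rightarrow> 'a ell2 \<Rightarrow> 'a ell2" where
  "scaleR r x = complex_of_real r *\<^sub>C x"

definition inner_ell2 :: "'a ell2 \<Rightarrow> 'a ell2 \<Rightarrow> real" where
  "inner x y = Re (cinner x y)"

definition norm_ell2 :: "'a ell2 \<Rightarrow> real" where
  "norm x = sqrt (\<Sum>\<^sub>\<infinity>i. (cmod (coord x i))\<^sup>2)"

definition sgn_ell2 :: "'a ell2 \<Rightarrow> 'a ell2" where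
  "sgn x = inverse (norm x) *\<^sub>R (x :: 'a ell2)"

definition dist_ell2 :: "'a ell2 \<Rightarrow> 'a ell2 \<Rightarrow> real" where
  "dist x y = norm (x - y :: 'a ell2)"

definition uniformity_ell2 :: "('a ell2 \<times> 'a ell2) filter" where
  "uniformity_ell2 = (INF e\<in>{0<..}. principal {(x, y). dist (x :: 'a ell2) y < e})"

definition open_ell2 :: "'a ell2 set \<Rightarrow> bool" where
  "open_ell2 U \<longleftrightarrow> (\<forall>x\<in>U. eventually (\<lambda>(x', y). x' = x \<longrightarrow> y \<in> U) uniformity)"

instance
proof
  fix x y z :: "'a ell2" and r s :: real and U :: "'a ell2 set"
  show "x + y + z = x + (y + z)" by transfer (simp add: add.assoc)
  show "x + y = y + x" by transfer (simp add: add.commute)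
  show "0 + x = x" by transfer simp
  show "- x + x = 0" by transfer simp
  show "x - y = x + - y" by (simp add: minus_ell2_def)
  show "r *\<^sub>R (x + y) = r *\<^sub>R x + r *\<^sub>R y"
    unfolding scaleR_ell2_def by transfer (simp add: distrib_left)
  show "(r + s) *\<^sub>R x = r *\<^sub>R x + s *\<^sub>R x"
    unfolding scaleR_ell2_def by transfer (simp add: distrib_right)
  show "r *\<^sub>R s *\<^sub>R x = (r * s) *\<^sub>R x"
    unfolding scaleR_ell2_def by transfer (simp add: mult.assoc)
  show "1 *\<^sub>R x = x"
    unfolding scaleR_ell2_def by transfer simp
  show "sgn x = inverse (norm x) *\<^sub>R x" by (rule sgn_ell2_def)
  show "dist x y = norm (x - y)" by (rule dist_ell2_def)
  show "uniformity = (INF e\<in>{0<..}. principal {(x, y). dist (x :: 'a ell2) y < e})"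
    by (rule uniformity_ell2_def)
  show "open U \<longleftrightarrow> (\<forall>x\<in>U. \<forall>\<^sub>F (x', y) in uniformity. x' = x \<longrightarrow> y \<in> U)"
    by (rule open_ell2_def)
  have self: "inner x x = (\<Sum>\<^sub>\<infinity>i. (cmod (coord x i))\<^sup>2)" for x :: "'a ell2"
  proof -
    have "inner x x = (\<Sum>\<^sub>\<infinity>i. Re (coord x i * cnj (coord x i)))"
      unfolding inner_ell2_def cinner_def by (rule infsum_Re[symmetric], rule cinner_summable)
    then show ?thesis
      by (simp only: complex_norm_square[symmetric] Re_complex_of_real)
  qed
  have "cinner x y = cnj (cinner y x)"
    unfolding cinner_def by (simp add: mult.commute flip: infsum_cnj)
  then show "inner x y = inner y x" by (simp add: inner_ell2_def)
  have "cinner (x + y) z = cinner x z + cinner y z"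
    unfolding cinner_def
    by (simp add: plus_ell2.rep_eq distrib_right infsum_add cinner_summable)
  then show "inner (x + y) z = inner x z + inner y z" by (simp add: inner_ell2_def)
  have "cinner (r *\<^sub>R x) y = complex_of_real r * cinner x y"
    unfolding cinner_def scaleR_ell2_def
    by (simp add: scaleC.rep_eq mult.assoc infsum_cmult_right')
  then show "inner (r *\<^sub>R x) y = r * inner x y" by (simp add: inner_ell2_def)
  show "0 \<le> inner x x" unfolding self by (rule infsum_nonneg) simp
  show "inner x x = 0 \<longleftrightarrow> x = 0"
  proof
    assume "inner x x = 0"
    then have "(cmod (coord x i))\<^sup>2 = 0" for i
      unfolding self using coord_summable[of x]
      by (intro nonneg_infsum_le_0D[where A = UNIV]) auto
    then show "x = 0" by (intro ell2_eqI) (simp add: zero_ell2.rep_eq)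
  next
    assume "x = 0"
    then show "inner x x = 0" unfolding self by (simp add: zero_ell2.rep_eq)
  qed
  show "norm x = sqrt (inner x x)" unfolding self by (rule norm_ell2_def)
qed

end

text \<open>Complex span and complex dimension; \<open>span\<close> and \<open>dim\<close> of the library are the real ones.\<close>

global_interpretation cvec: vector_space "scaleC :: complex \<Rightarrow> 'a ell2 \<Rightarrow> 'a ell2"
  by unfold_locales (transfer; simp add: algebra_simps)+

definition cfinite_dim :: "'a ell2 set \<Rightarrow> bool" where
  "cfinite_dim V \<longleftrightarrow> (\<exists>B. finite B \<and> V \<subseteq> cvec.span B)"

lift_definition ket :: "'a \<Rightarrow> 'a ell2" is "\<lambda>a b. if b = a then 1 else 0"
proof -
  fix a :: 'a
  have "(\<lambda>b. (cmod (if b = a then 1 else 0))\<^sup>2) summable_on {a}" by simp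
  then show "(\<lambda>b. (cmod (if b = a then 1 else 0))\<^sup>2) summable_on UNIV"
    by (rule summable_on_cong_neutral[THEN iffD1, rotated -1]) auto
qed


section \<open>Operators on a closed subspace\<close>

text \<open>
  In this section \<open>H\<close> is a closed complex subspace of an \<open>\<ell>\<^sup>2\<close>-space, regarded as a Hilbert
  space in its own right.  Only the values of an operator on \<open>H\<close> matter.
\<close>

definition clinear_on :: "'a ell2 set \<Rightarrow> ('a ell2 \<Rightarrow> 'a ell2) \<Rightarrow> bool" where
  "clinear_on H T \<longleftrightarrow>
     (\<forall>x\<in>H. T x \<in> H) \<and>
     (\<forall>x\<in>H. \<forall>y\<in>H. T (x + y) = T x + T y) \<and>
     (\<forall>c. \<forall>x\<in>H. T (c *\<^sub>C x) = c *\<^sub>C T x)"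

definition bounded_clinear_on :: "'a ell2 set \<Rightarrow> ('a ell2 \<Rightarrow> 'a ell2) \<Rightarrow> bool" where
  "bounded_clinear_on H T \<longleftrightarrow> clinear_on H T \<and> (\<exists>K. \<forall>x\<in>H. norm (T x) \<le> K * norm x)"

definition isometry_on :: "'a ell2 set \<Rightarrow> ('a ell2 \<Rightarrow> 'a ell2) \<Rightarrow> bool" where
  "isometry_on H T \<longleftrightarrow> clinear_on H T \<and> (\<forall>x\<in>H. norm (T x) = norm x)"

definition adjoint_on :: "'a ell2 set \<Rightarrow> ('a ell2 \<Rightarrow> 'a ell2) \<Rightarrow> 'a ell2 \<Rightarrow> 'a ell2" where
  "adjoint_on H T y = (THE z. z \<in> H \<and> (\<forall>x\<in>H. cinner (T x) y = cinner x z))"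

definition kernel_on :: "'a ell2 set \<Rightarrow> ('a ell2 \<Rightarrow> 'a ell2) \<Rightarrow> 'a ell2 set" where
  "kernel_on H T = {x \<in> H. T x = 0}"

definition compact_operator_on :: "'a ell2 set \<Rightarrow> ('a ell2 \<Rightarrow> 'a ell2) \<Rightarrow> bool" where
  "compact_operator_on H T \<longleftrightarrow> clinear_on H T \<and> compact (closure (T ` (cball 0 1 \<inter> H)))"

definition fredholm_on :: "'a ell2 set \<Rightarrow> ('a ell2 \<Rightarrow> 'a ell2) \<Rightarrow> bool" where
  "fredholm_on H T \<longleftrightarrow>
     bounded_clinear_on H T \<and> closed (T ` H) \<and>
     cfinite_dim (kernel_on H T) \<and> cfinite_dim (kernel_on H (adjoint_on H T))"

definition index_on :: "'a ell2 set \<Rightarrow> ('a ell2 \<Rightarrow> 'a ell2) \<Rightarrow> int" where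
  "index_on H T = int (cvec.dim (kernel_on H T)) - int (cvec.dim (kernel_on H (adjoint_on H T)))"


section \<open>The full Fock space and the scalar odometer map\<close>

definition words :: "nat \<Rightarrow> nat list set" where
  "words n = lists {1..n}"

text \<open>
  The full Fock space is realised by the coordinates of its vectors in the canonical orthonormal
  basis: \<open>ket \<mu>\<close> with \<open>\<mu> \<in> words n\<close> is the basis vector \<open>e\<^sub>\<mu>\<close>, concatenation of words is the
  tensor product of basis vectors, and \<open>ket []\<close> is the vacuum.
\<close>

definition fock :: "nat \<Rightarrow> nat list ell2 set" where
  "fock n = {x. \<forall>\<mu>. \<mu> \<notin> words n \<longrightarrow> coord x \<mu> = 0}"

text \<open>The left creation operators.\<close>

lift_definition creation :: "nat \<Rightarrow> nat list ell2 \<Rightarrow> nat list ell2"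
  is "\<lambda>i f \<mu>. case \<mu> of [] \<Rightarrow> 0 | j # \<nu> \<Rightarrow> if j = i then f \<nu> else 0"
proof -
  fix i :: nat and f :: "nat list \<Rightarrow> complex"
  let ?g = "\<lambda>\<mu>. (cmod (case \<mu> of [] \<Rightarrow> 0 | j # \<nu> \<Rightarrow> if j = i then f \<nu> else 0))\<^sup>2"
  assume "(\<lambda>\<mu>. (cmod (f \<mu>))\<^sup>2) summable_on UNIV"
  then have "?g summable_on range ((#) i)"
    by (subst summable_on_reindex) (auto simp: o_def)
  then show "?g summable_on UNIV"
    by (rule summable_on_cong_neutral[THEN iffD1, rotated -1]) (auto split: list.splits)
qed

lemma creation_ket: "creation i (ket \<mu>) = ket (i # \<mu>)"
  by (rule ell2_eqI) (auto simp: creation.rep_eq ket.rep_eq split: list.splits)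

text \<open>
  The prescription for the image of \<open>e\<^sub>\<mu>\<close>.  Positions are counted from 0, so \<open>r\<close> below is one
  less than the usual position of the first letter different from \<open>n\<close>.
\<close>

definition odometer_basis :: "nat \<Rightarrow> nat list ell2 \<Rightarrow> nat list \<Rightarrow> nat list ell2" where
  "odometer_basis n \<xi> \<mu> =
     (if \<exists>j<length \<mu>. \<mu> ! j \<noteq> n
      then let r = (LEAST j. j < length \<mu> \<and> \<mu> ! j \<noteq> n)
           in ket (replicate r 1 @ (\<mu> ! r + 1) # drop (r + 1) \<mu>)
      else (creation 1 ^^ length \<mu>) \<xi>)"

text \<open>
  The extension of the prescription to the Fock space by \<open>\<Sum>\<^sub>\<mu> x\<^sub>\<mu> e\<^sub>\<mu> \<mapsto> \<Sum>\<^sub>\<mu> x\<^sub>\<mu> W\<^sub>\<xi> e\<^sub>\<mu>\<close>, the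
  series being taken in norm.  By convention \<open>infsum\<close> is 0 where the series diverges, so this is
  an isometry exactly if the prescription extends to one; see \<open>isometry_on_odometer_iff\<close>.
\<close>

definition odometer :: "nat \<Rightarrow> nat list ell2 \<Rightarrow> nat list ell2 \<Rightarrow> nat list ell2" where
  "odometer n \<xi> x = (\<Sum>\<^sub>\<infinity>\<mu>\<in>words n. coord x \<mu> *\<^sub>C odometer_basis n \<xi> \<mu>)"

lemma fock_zero: "0 \<in> fock n"
  and fock_add: "x \<in> fock n \<Longrightarrow> y \<in> fock n \<Longrightarrow> x + y \<in> fock n"
  and fock_scaleC: "x \<in> fock n \<Longrightarrow> c *\<^sub>C x \<in> fock n"
  and fock_ket: "\<mu> \<in> words n \<Longrightarrow> ket \<mu> \<in> fock n"
  by (auto simp: fock_def zero_ell2.rep_eq plus_ell2.rep_eq scaleC.rep_eq ket.rep_eq)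

lemma coord_sum: "coord (\<Sum>a\<in>A. f a) i = (\<Sum>a\<in>A. coord (f a) i)"
  by (induction A rule: infinite_finite_induct) (auto simp: zero_ell2.rep_eq plus_ell2.rep_eq)

lemma has_sum_ket:
  assumes "\<And>i. i \<notin> A \<Longrightarrow> coord x i = 0"
  shows "((\<lambda>a. coord x a *\<^sub>C ket a) has_sum x) A"
proof -
  let ?q = "\<lambda>i. (cmod (coord x i))\<^sup>2"
  let ?S = "\<lambda>F. \<Sum>a\<in>F. coord x a *\<^sub>C ket a"
  have sA: "(?q has_sum infsum ?q UNIV) A"
  proof -
    have "(?q has_sum infsum ?q UNIV) UNIV"
      using coord_summable by (rule has_sum_infsum)
    then show ?thesis
      by (rule has_sum_cong_neutral[THEN iffD1, rotated -1]) (auto simp: assms)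
  qed
  have eq: "norm (x - ?S F) = sqrt (infsum ?q UNIV - sum ?q F)" if "finite F" for F
  proof -
    have c: "coord (x - ?S F) i = (if i \<in> F then 0 else coord x i)" for i
    proof -
      have k: "coord (coord x a *\<^sub>C ket a) i = (if i = a then coord x a else 0)" for a
        by (simp add: scaleC.rep_eq ket.rep_eq)
      have "coord (?S F) i = (if i \<in> F then coord x i else 0)"
        unfolding coord_sum k using that by (rule sum.delta')
      then show ?thesis
        unfolding minus_ell2_def plus_ell2.rep_eq uminus_ell2.rep_eq by simp
    qed
    have "(\<Sum>\<^sub>\<infinity>i. (cmod (coord (x - ?S F) i))\<^sup>2) = infsum ?q (UNIV - F)"
      by (rule infsum_cong_neutral) (auto simp: c)
    also have "\<dots> = infsum ?q UNIV - infsum ?q F"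
      by (rule infsum_Diff) (auto simp: coord_summable that)
    finally show ?thesis using that by (simp add: norm_ell2_def)
  qed
  have "((\<lambda>F. sqrt (infsum ?q UNIV - sum ?q F)) \<longlongrightarrow> sqrt (infsum ?q UNIV - infsum ?q UNIV))
      (finite_subsets_at_top A)"
    using sA unfolding has_sum_def by (intro tendsto_intros)
  then have "((\<lambda>F. sqrt (infsum ?q UNIV - sum ?q F)) \<longlongrightarrow> 0) (finite_subsets_at_top A)"
    by simp
  then have "((\<lambda>F. norm (x - ?S F)) \<longlongrightarrow> 0) (finite_subsets_at_top A)"
    by (rule Lim_transform_eventually)
       (rule eventually_finite_subsets_at_top_weakI, simp only: eq)
  then have "((\<lambda>F. norm (?S F - x)) \<longlongrightarrow> 0) (finite_subsets_at_top A)"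
    by (simp add: norm_minus_commute)
  then show ?thesis
    unfolding has_sum_def by (rule LIM_zero_cancel[OF tendsto_norm_zero_cancel])
qed

lemma odometer_ket:
  assumes "\<mu> \<in> words n"
  shows "odometer n \<xi> (ket \<mu>) = odometer_basis n \<xi> \<mu>"
proof -
  have "odometer n \<xi> (ket \<mu>) = (\<Sum>\<^sub>\<infinity>\<nu>\<in>{\<mu>}. coord (ket \<mu>) \<nu> *\<^sub>C odometer_basis n \<xi> \<nu>)"
    unfolding odometer_def using assms
    by (intro infsum_cong_neutral) (auto simp: ket.rep_eq)
  then show ?thesis by (simp add: ket.rep_eq)
qed

lemma isometry_extension_eq_odometer:
  assumes T: "isometry_on (fock n) T"
    and ket: "\<And>\<mu>. \<mu> \<in> words n \<Longrightarrow> T (ket \<mu>) = odometer_basis n \<xi> \<mu>"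
    and x: "x \<in> fock n"
  shows "odometer n \<xi> x = T x"
proof -
  let ?S = "\<lambda>F. \<Sum>\<mu>\<in>F. coord x \<mu> *\<^sub>C ket \<mu>"
  have add: "T (u + v) = T u + T v" if "u \<in> fock n" "v \<in> fock n" for u v
    using T that by (simp add: isometry_on_def clinear_on_def)
  have scale: "T (c *\<^sub>C u) = c *\<^sub>C T u" if "u \<in> fock n" for c u
    using T that by (simp add: isometry_on_def clinear_on_def)
  have iso: "norm (T u) = norm u" if "u \<in> fock n" for u
    using T that by (simp add: isometry_on_def)
  have S: "?S F \<in> fock n \<and> T (?S F) = (\<Sum>\<mu>\<in>F. coord x \<mu> *\<^sub>C odometer_basis n \<xi> \<mu>)"
    if "finite F" "F \<subseteq> words n" for F
    using that
  proof (induction F rule: finite_induct)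
    case empty
    have "T (0 *\<^sub>C 0) = 0 *\<^sub>C T 0" by (rule scale[OF fock_zero])
    then show ?case by (simp add: fock_zero)
  next
    case (insert \<mu> F)
    then show ?case by (simp add: add scale ket fock_add fock_scaleC fock_ket)
  qed
  have diff: "norm ((\<Sum>\<mu>\<in>F. coord x \<mu> *\<^sub>C odometer_basis n \<xi> \<mu>) - T x) = norm (?S F - x)"
    if "finite F" "F \<subseteq> words n" for F
  proof -
    have m: "u - v = u + (- 1) *\<^sub>C v" for u v :: "nat list ell2"
      by (simp add: cvec.scale_minus_left)
    have "(\<Sum>\<mu>\<in>F. coord x \<mu> *\<^sub>C odometer_basis n \<xi> \<mu>) - T x = T (?S F - x)"
      using S[OF that] x unfolding m by (simp only: add scale fock_scaleC)
    moreover have "?S F - x \<in> fock n"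
      unfolding m using S[OF that] x by (intro fock_add fock_scaleC) auto
    ultimately show ?thesis by (simp only: iso)
  qed
  have "((\<lambda>\<mu>. coord x \<mu> *\<^sub>C ket \<mu>) has_sum x) (words n)"
    using x by (intro has_sum_ket) (auto simp: fock_def)
  then have "((\<lambda>F. norm (?S F - x)) \<longlongrightarrow> 0) (finite_subsets_at_top (words n))"
    unfolding has_sum_def by (intro tendsto_norm_zero LIM_zero)
  then have "((\<lambda>F. norm ((\<Sum>\<mu>\<in>F. coord x \<mu> *\<^sub>C odometer_basis n \<xi> \<mu>) - T x)) \<longlongrightarrow> 0)
      (finite_subsets_at_top (words n))"
    by (rule Lim_transform_eventually)
       (rule eventually_finite_subsets_at_top_weakI, simp add: diff)
  then have "((\<lambda>\<mu>. coord x \<mu> *\<^sub>C odometer_basis n \<xi> \<mu>) has_sum T x) (words n)"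
    unfolding has_sum_def by (rule LIM_zero_cancel[OF tendsto_norm_zero_cancel])
  then show ?thesis unfolding odometer_def by (rule infsumI)
qed

lemma isometry_on_odometer_iff:
  "isometry_on (fock n) (odometer n \<xi>) \<longleftrightarrow>
     (\<exists>T. isometry_on (fock n) T \<and> (\<forall>\<mu>\<in>words n. T (ket \<mu>) = odometer_basis n \<xi> \<mu>))"
proof
  assume "isometry_on (fock n) (odometer n \<xi>)"
  then show "\<exists>T. isometry_on (fock n) T \<and> (\<forall>\<mu>\<in>words n. T (ket \<mu>) = odometer_basis n \<xi> \<mu>)"
    using odometer_ket by blast
next
  assume "\<exists>T. isometry_on (fock n) T \<and> (\<forall>\<mu>\<in>words n. T (ket \<mu>) = odometer_basis n \<xi> \<mu>)"
  then obtain T where T: "isometry_on (fock n) T"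
    and "\<And>\<mu>. \<mu> \<in> words n \<Longrightarrow> T (ket \<mu>) = odometer_basis n \<xi> \<mu>" by blast
  then have "odometer n \<xi> x = T x" if "x \<in> fock n" for x
    using isometry_extension_eq_odometer that by blast
  with T show "isometry_on (fock n) (odometer n \<xi>)"
    by (simp add: isometry_on_def clinear_on_def fock_add fock_scaleC)
qed

definition isometric_scalar_symbol :: "nat \<Rightarrow> nat list ell2 \<Rightarrow> bool" where
  "isometric_scalar_symbol n \<xi> \<longleftrightarrow> \<xi> \<in> fock n \<and> isometry_on (fock n) (odometer n \<xi>)"

definition M_perp :: "nat list ell2 set" where
  "M_perp = closure (cvec.span (range (\<lambda>p. ket (replicate p 1))))"

text \<open>
  The unitary from \<open>M_perp\<close> onto the Hardy space sending \<open>ket (replicate p 1)\<close> to \<open>z\<^sup>p\<close>.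
  A Hardy space function is represented by its Taylor series, evaluated in the open unit disc.
\<close>

definition U1 :: "nat list ell2 \<Rightarrow> complex \<Rightarrow> complex" where
  "U1 \<xi> z = (\<Sum>p. coord \<xi> (replicate p 1) * z ^ p)"

definition finite_blaschke_symbol :: "nat \<Rightarrow> nat list ell2 \<Rightarrow> nat \<Rightarrow> bool" where
  "finite_blaschke_symbol n \<xi> d \<longleftrightarrow>
     isometric_scalar_symbol n \<xi> \<and> \<xi> \<in> M_perp \<and>
     (\<exists>l a. cmod l = 1 \<and> (\<forall>j\<in>{1..d}. cmod (a j) < 1) \<and>
        (\<forall>z\<in>ball 0 1. U1 \<xi> z = l * (\<Prod>j=1..d. (z - a j) / (1 - cnj (a j) * z))))"

end

(*
  The odometer maps the basis vectors indexed by words other than n^m bijectively onto those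
  indexed by words other than 1^m, so isometry forces \<xi> into M_perp, and on the remaining
  basis vectors W acts as multiplication by \<Theta> on the Hardy space.  Hence ker W* is the model
  space K of \<Theta>, the orthogonal complement of \<Theta> H^2; as W is an isometry and I - W W* is the
  projection onto ker W*, both Fredholmness and compactness say that K is finite-dimensional.

  If \<xi> = b_a \<eta> with a Blaschke factor b_a and S is the shift, then K(\<xi>) is the preimage of
  K(\<eta>) under S* - cnj a, which is onto with one-dimensional kernel, so dim K(\<xi>) = dim K(\<eta>) + 1.
  This gives dim K = d for a Blaschke product of degree d.  Conversely, if K is nonzero and
  finite-dimensional, S* has an eigenvector in it, necessarily a reproducing kernel, so \<Theta> has a
  zero in the disc; dividing out the Blaschke factor leaves an inner function, and induction on
  dim K applies.  If K = 0, then S* \<xi>, which always lies in K, vanishes and \<Theta> is constant.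
*)
theory Submission
  imports Defs "HOL-Computational_Algebra.Fundamental_Theorem_Algebra"
begin

section \<open>Complex inner product geometry\<close>

text \<open>Neither boundary values on the circle nor products of Hardy space vectors are formed.
  Being inner means that the shift orbit is orthonormal, and \<xi> = b_a \<eta> becomes the linear
  equation (1 - cnj a S) \<xi> = (S - a) \<eta>. Multiplying and dividing by a Blaschke factor are
  then first-order recursions on Taylor coefficients, whose analytic content is the square
  summability of the solutions. The price is paid where the quotient has to be inner again, which on
  the circle would be immediate from |b_a| = 1: there the autocorrelations <S^m \<xi>, \<xi>> are
  compared instead. On the Fock space, completeness of \<open>ell2\<close> is never invoked:
  Bessel's inequality makes the candidate coordinates of the adjoint square summable, and the range
  is closed because it is the zero set of a bounded projection. Orthogonalisation and compactness
  arguments run over the real scalars while kernels are measured in complex dimension, so spans have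
  to be transferred between the two.\<close>

lemma cinner_commute: "cinner x y = cnj (cinner y x)"
  unfolding cinner_def by (simp add: mult.commute flip: infsum_cnj)

lemma cinner_add_left: "cinner (x + y) z = cinner x z + cinner y z"
  unfolding cinner_def
  by (simp add: plus_ell2.rep_eq distrib_right infsum_add cinner_summable)

lemma cinner_scaleC_left: "cinner (c *\<^sub>C x) y = c * cinner x y"
  unfolding cinner_def by (simp add: scaleC.rep_eq mult.assoc infsum_cmult_right')

lemma cinner_add_right: "cinner z (x + y) = cinner z x + cinner z y"
  using cinner_commute[of z] by (simp add: cinner_add_left)

lemma cinner_scaleC_right: "cinner y (c *\<^sub>C x) = cnj c * cinner y x"
  using cinner_commute[of y] by (simp add: cinner_scaleC_left)

lemma cinner_minus_left: "cinner (- x) y = - cinner x y"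
  using cinner_scaleC_left[of "-1" x y] by (simp add: cvec.scale_minus_left)

lemma cinner_minus_right: "cinner y (- x) = - cinner y x"
  using cinner_scaleC_right[of y "-1" x] by (simp add: cvec.scale_minus_left)

lemma cinner_diff_left: "cinner (x - y) z = cinner x z - cinner y z"
  using cinner_add_left[of x "- y"] by (simp add: cinner_minus_left)

lemma cinner_diff_right: "cinner z (x - y) = cinner z x - cinner z y"
  using cinner_add_right[of z x "- y"] by (simp add: cinner_minus_right)

lemma cinner_zero_left: "cinner 0 y = 0"
  using cinner_scaleC_left[of 0 0 y] by simp

lemma cinner_zero_right: "cinner y 0 = 0"
  using cinner_scaleC_right[of y 0 0] by simp

lemma cinner_sum_left: "cinner (\<Sum>a\<in>A. f a) y = (\<Sum>a\<in>A. cinner (f a) y)"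
  by (induction A rule: infinite_finite_induct) (auto simp: cinner_zero_left cinner_add_left)

lemma cinner_sum_right: "cinner y (\<Sum>a\<in>A. f a) = (\<Sum>a\<in>A. cinner y (f a))"
  by (induction A rule: infinite_finite_induct) (auto simp: cinner_zero_right cinner_add_right)

lemmas cinner_simps =
  cinner_add_left cinner_add_right cinner_scaleC_left cinner_scaleC_right
  cinner_minus_left cinner_minus_right cinner_diff_left cinner_diff_right
  cinner_zero_left cinner_zero_right

lemma cinner_self: "cinner x x = complex_of_real ((norm x)\<^sup>2)"
proof -
  have "Im (cinner x x) = 0"
    using arg_cong[OF cinner_commute[of x x], of Im] by simp
  moreover have "Re (cinner x x) = (norm x)\<^sup>2"
    by (simp add: power2_norm_eq_inner inner_ell2_def)
  ultimately show ?thesis by (simp add: complex_eq_iff)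
qed

lemma norm_scaleC: "norm (c *\<^sub>C x) = cmod c * norm x"
proof -
  have "complex_of_real ((norm (c *\<^sub>C x))\<^sup>2) = complex_of_real ((cmod c * norm x)\<^sup>2)"
    unfolding cinner_self[symmetric] cinner_scaleC_left cinner_scaleC_right
    by (simp add: cinner_self power_mult_distrib complex_norm_square[of c] mult_ac
        del: of_real_power flip: of_real_power)
  then have "(norm (c *\<^sub>C x))\<^sup>2 = (cmod c * norm x)\<^sup>2" by (rule of_real_eq_iff[THEN iffD1])
  then show ?thesis by (simp add: power2_eq_iff_nonneg)
qed

lemma norm_cinner_le: "cmod (cinner x y) \<le> norm x * norm y"
proof (cases "cinner x y = 0")
  case False
  \<comment> \<open>A unimodular factor that rotates the inner product onto the positive real axis,
    where the real Cauchy-Schwarz inequality applies.\<close>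
  define c where "c = cnj (sgn (cinner x y))"
  have c: "cmod c = 1" using False by (simp add: c_def norm_sgn)
  have "c * cinner x y = complex_of_real (cmod (cinner x y))"
    using False unfolding c_def sgn_eq
    using complex_norm_square[of "cinner x y"]
    by (simp add: field_simps power2_eq_square)
  then have "cmod (cinner x y) = inner (c *\<^sub>C x) y"
    by (simp add: inner_ell2_def cinner_scaleC_left)
  also have "\<dots> \<le> norm (c *\<^sub>C x) * norm y" by (rule norm_cauchy_schwarz)
  finally show ?thesis by (simp add: norm_scaleC c)
qed simp

lemma bounded_linear_cinner_left: "bounded_linear (\<lambda>x. cinner x y)"
  by (rule bounded_linear_intro[where K = "norm y"])
     (auto simp: cinner_simps scaleR_ell2_def norm_cinner_le scaleR_conv_of_real)

lemma coord_zero [simp]: "coord 0 i = 0"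
  and coord_add [simp]: "coord (x + y) i = coord x i + coord y i"
  and coord_scaleC [simp]: "coord (c *\<^sub>C x) i = c * coord x i"
  and coord_uminus [simp]: "coord (- x) i = - coord x i"
  and coord_diff [simp]: "coord (x - y) i = coord x i - coord y i"
  and coord_ket [simp]: "coord (ket j) i = (if i = j then 1 else 0)"
  unfolding minus_ell2_def
  by (simp_all only: zero_ell2.rep_eq plus_ell2.rep_eq scaleC.rep_eq uminus_ell2.rep_eq
      ket.rep_eq diff_conv_add_uminus)

lemma cinner_ket_right: "cinner x (ket i) = coord x i"
proof -
  have "cinner x (ket i) = (\<Sum>\<^sub>\<infinity>j\<in>{i}. coord x j * cnj (coord (ket i) j))"
    unfolding cinner_def by (rule infsum_cong_neutral) auto
  then show ?thesis by simp
qed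

lemma cinner_ket_left: "cinner (ket i) x = cnj (coord x i)"
  using cinner_commute[of "ket i" x] by (simp add: cinner_ket_right)

lemma norm_ket [simp]: "norm (ket i) = 1"
  unfolding norm_eq_sqrt_inner inner_ell2_def by (simp add: cinner_ket_right)

lemma norm_coord_le: "cmod (coord x i) \<le> norm x"
  using norm_cinner_le[of x "ket i"] by (simp add: cinner_ket_right)

lemma coord_scaleR [simp]: "coord (r *\<^sub>R x) i = complex_of_real r * coord x i"
  by (simp add: scaleR_ell2_def)

lemma coord_Abs_ell2:
  assumes "(\<lambda>i. (cmod (f i))\<^sup>2) summable_on UNIV"
  shows "coord (Abs_ell2 f) = f"
  using assms by (simp add: Abs_ell2_inverse)

text \<open>Polarisation: the norm of \<open>x + y\<close> gives the real part, that of
  \<open>x + \<i> *\<^sub>C y\<close> the imaginary part, since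
  \<open>Re (cinner x (\<i> *\<^sub>C y)) = Im (cinner x y)\<close>. Assuming only norms makes it
  usable for maps that are linear merely on a subspace.\<close>

lemma cinner_eq_if_norm_eq:
  assumes add: "norm (x' + y') = norm (x + y)" and addi: "norm (x' + \<i> *\<^sub>C y') = norm (x + \<i> *\<^sub>C y)"
    and x: "norm x' = norm x" and y: "norm y' = norm y"
  shows "cinner x' y' = cinner x y"
proof -
  have p: "(norm (u + v))\<^sup>2 = (norm u)\<^sup>2 + (norm v)\<^sup>2 + 2 * Re (cinner u v)" for u v :: "'c ell2"
    using dot_norm[of u v] by (simp add: inner_ell2_def)
  have "Re (cinner x' y') = Re (cinner x y)"
    using p[of x' y'] p[of x y] by (simp add: add x y)
  moreover have "Re (cinner x' (\<i> *\<^sub>C y')) = Re (cinner x (\<i> *\<^sub>C y))"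
    using p[of x' "\<i> *\<^sub>C y'"] p[of x "\<i> *\<^sub>C y"] by (simp add: addi x y norm_scaleC)
  ultimately show ?thesis by (simp add: cinner_simps complex_eq_iff)
qed

section \<open>Finite-dimensional subspaces\<close>

text \<open>\<open>cvec.dim\<close> is 0 on infinite-dimensional spaces too, so a dimension is
  recorded together with a finite basis.\<close>

definition has_cdim :: "'a ell2 set \<Rightarrow> nat \<Rightarrow> bool" where
  "has_cdim V d \<longleftrightarrow>
     (\<exists>B. finite B \<and> \<not> cvec.dependent B \<and> cvec.span B = V \<and> card B = d)"

lemma has_cdim_dim: "has_cdim V d \<Longrightarrow> cvec.dim V = d"
  unfolding has_cdim_def by (metis cvec.dim_span_eq_card_independent)

lemma has_cdim_imp_cfinite_dim: "has_cdim V d \<Longrightarrow> cfinite_dim V"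
  unfolding has_cdim_def cfinite_dim_def by blast

lemma cfinite_dim_imp_has_cdim:
  assumes V: "cvec.subspace V" and fin: "cfinite_dim V"
  obtains d where "has_cdim V d"
proof -
  obtain C where C: "finite C" "V \<subseteq> cvec.span C" using fin by (auto simp: cfinite_dim_def)
  obtain B where B: "B \<subseteq> V" "\<not> cvec.dependent B" "V \<subseteq> cvec.span B"
    using cvec.maximal_independent_subset by blast
  have "finite B" using cvec.independent_span_bound[OF C(1) B(2)] B(1) C(2) by blast
  moreover have "cvec.span B = V" using B V cvec.span_subspace by blast
  ultimately show thesis using B that unfolding has_cdim_def by blast
qed

lemma has_cdim_0: "has_cdim V 0 \<longleftrightarrow> V = {0}"
  unfolding has_cdim_def using cvec.independent_empty by auto

lemma has_cdim_linear_image: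
  assumes f: "module_hom scaleC scaleC f" and inj: "inj f" and V: "has_cdim V d"
  shows "has_cdim (f ` V) d"
proof -
  obtain B where B: "finite B" "\<not> cvec.dependent B" "cvec.span B = V" "card B = d"
    using V unfolding has_cdim_def by blast
  have "\<not> cvec.dependent (f ` B)" using module_hom.independent_inj_image[OF f B(2) inj] .
  moreover have "cvec.span (f ` B) = f ` V" using module_hom.span_image[OF f, of B] B by simp
  moreover have "card (f ` B) = d" using B inj by (metis card_image inj_on_subset subset_UNIV)
  ultimately show ?thesis using B(1) unfolding has_cdim_def by blast
qed

lemma cfinite_dim_linear_image:
  assumes f: "module_hom scaleC scaleC f" and V: "cfinite_dim V"
  shows "cfinite_dim (f ` V)"
  using V module_hom.spans_image[OF f] unfolding cfinite_dim_def by (meson finite_imageI)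

lemma cfinite_dim_inj_image:
  assumes f: "module_hom scaleC scaleC f" and inj: "inj f" and V: "cvec.subspace V"
    and im: "cfinite_dim (f ` V)"
  shows "cfinite_dim V"
proof -
  obtain C where C: "finite C" "f ` V \<subseteq> cvec.span C" using im by (auto simp: cfinite_dim_def)
  obtain B where B: "B \<subseteq> V" "\<not> cvec.dependent B" "V \<subseteq> cvec.span B"
    using cvec.maximal_independent_subset by blast
  have "\<not> cvec.dependent (f ` B)" using module_hom.independent_inj_image[OF f B(2) inj] .
  moreover have "f ` B \<subseteq> cvec.span C" using B C by blast
  ultimately have "finite (f ` B)" using cvec.independent_span_bound[OF C(1)] by blast
  then have "finite B" using inj by (meson finite_imageD inj_on_subset subset_UNIV)
  then show ?thesis using B unfolding cfinite_dim_def by blast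
qed

text \<open>Lifting a basis of \<open>V\<close> through a right inverse of \<open>f\<close> and
  adding the kernel vector \<open>g\<close> gives a basis: \<open>f\<close> is injective on the span
  of the lifts, which therefore misses \<open>g\<close>.\<close>

lemma has_cdim_vimage:
  assumes f: "module_hom scaleC scaleC f" and surj: "surj f"
    and ker: "\<And>x. f x = 0 \<longleftrightarrow> x \<in> cvec.span {g}" and g: "g \<noteq> 0"
    and V: "has_cdim V d"
  shows "has_cdim (f -` V) (Suc d)"
proof -
  obtain B where B: "finite B" "\<not> cvec.dependent B" "cvec.span B = V" "card B = d"
    using V unfolding has_cdim_def by blast
  interpret f: module_hom scaleC scaleC f by (rule f)
  define s where "s = inv f"
  have fs: "f (s b) = b" for b unfolding s_def using surj by (simp add: surj_f_inv_f)
  have im: "f ` s ` B = B" by (simp add: image_image fs)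
  have injs: "inj_on s B" by (metis fs inj_onI)
  have "inj_on f (s ` B)" by (auto intro!: inj_onI simp: fs)
  then have inj: "inj_on f (cvec.span (s ` B))"
    using f.inj_on_span_independent_image[of "s ` B"] B(2) by (simp add: im)
  have ind: "\<not> cvec.dependent (s ` B)"
  proof
    assume "cvec.dependent (s ` B)"
    then obtain a where a: "a \<in> s ` B" "a \<in> cvec.span (s ` B - {a})"
      by (auto simp: cvec.dependent_def)
    have "f ` (s ` B - {a}) = f ` (s ` B) - f ` {a}"
      by (rule inj_on_image_set_diff[OF \<open>inj_on f (s ` B)\<close>]) (use a(1) in auto)
    then have "f ` (s ` B - {a}) = B - {f a}" by (simp add: im)
    then have "f a \<in> cvec.span (B - {f a})" 
      using imageI[OF a(2), of f] f.span_image[of "s ` B - {a}"] by simp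
    moreover have "f a \<in> B" using a(1) by (auto simp: fs)
    ultimately show False using B(2) cvec.dependent_def by blast
  qed
  have fg: "f g = 0" using ker cvec.span_base by blast
  have gn: "g \<notin> cvec.span (s ` B)"
    using inj_onD[OF inj, of g 0] fg g cvec.span_zero by auto
  have "cvec.span (insert g (s ` B)) = f -` V"
  proof
    have "f ` (s ` B) \<subseteq> V" unfolding im using B(3) cvec.span_superset by blast
    then have "insert g (s ` B) \<subseteq> f -` V" using fg B(3) cvec.span_zero by auto
    moreover have "cvec.subspace (f -` V)"
      using f.subspace_vimage B(3) cvec.subspace_span by blast
    ultimately show "cvec.span (insert g (s ` B)) \<subseteq> f -` V" by (rule cvec.span_minimal)
  next
    show "f -` V \<subseteq> cvec.span (insert g (s ` B))"
    proof
      fix x assume "x \<in> f -` V"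
      then have "f x \<in> f ` cvec.span (s ` B)"
        using f.span_image[of "s ` B"] B(3) by (simp add: im)
      then obtain y where y: "y \<in> cvec.span (s ` B)" "f x = f y" by blast
      then have "x - y \<in> cvec.span {g}" using ker[of "x - y"] by (simp add: f.diff)
      then obtain c where "x - y = c *\<^sub>C g" by (auto simp: cvec.span_singleton)
      then have "x - c *\<^sub>C g = y" by (simp add: algebra_simps)
      then show "x \<in> cvec.span (insert g (s ` B))"
        using y cvec.span_breakdown_eq by metis
    qed
  qed
  moreover have "card (insert g (s ` B)) = Suc d"
    using gn B injs cvec.span_base[of g "s ` B"] by (subst card_insert_disjoint) (auto simp: card_image)
  moreover have "\<not> cvec.dependent (insert g (s ` B))"
    using ind gn cvec.independent_insertI by blast
  ultimately show ?thesis
    unfolding has_cdim_def by (intro exI[of _ "insert g (s ` B)"]) (simp add: B(1))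
qed

section \<open>Eigenvectors on finite-dimensional invariant subspaces\<close>

text \<open>The value of p(T) at \<open>x\<close> by Horner's scheme.\<close>

definition poly_op :: "('a ell2 \<Rightarrow> 'a ell2) \<Rightarrow> complex poly \<Rightarrow> 'a ell2 \<Rightarrow> 'a ell2" where
  "poly_op T p x = fold_coeffs (\<lambda>a y. a *\<^sub>C x + T y) p 0"

context
  fixes T :: "'a ell2 \<Rightarrow> 'a ell2"
  assumes T: "module_hom scaleC scaleC T"
begin

interpretation T: module_hom scaleC scaleC T by (rule T)

lemma poly_op_0 [simp]: "poly_op T 0 x = 0"
  by (simp add: poly_op_def)

lemma poly_op_pCons: "poly_op T (pCons a p) x = a *\<^sub>C x + T (poly_op T p x)"
  by (cases "p = 0 \<and> a = 0") (auto simp: poly_op_def)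

lemma poly_op_add: "poly_op T (p + q) x = poly_op T p x + poly_op T q x"
  by (induction p q rule: poly_induct2) (simp_all add: poly_op_pCons T.add cvec.scale_left_distrib)

lemma poly_op_smult: "poly_op T (smult c p) x = c *\<^sub>C poly_op T p x"
  by (induction p) (simp_all add: poly_op_pCons T.scale cvec.scale_right_distrib)

lemma poly_op_linear_factor_mult:
  "poly_op T ([:- b, 1:] * r) x = T (poly_op T r x) - b *\<^sub>C poly_op T r x"
proof -
  have "[:- b, 1:] * r = pCons 0 r + smult (- b) r" by simp
  then show ?thesis
    by (simp only: poly_op_add poly_op_smult poly_op_pCons) (simp add: cvec.scale_minus_left)
qed

lemma poly_op_monom: "poly_op T (monom 1 k) x = (T ^^ k) x"
  by (induction k) (simp_all add: poly_op_pCons monom_Suc monom_0 T.zero)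

lemma poly_op_in_subspace:
  assumes "cvec.subspace V" "\<And>y. y \<in> V \<Longrightarrow> T y \<in> V" "x \<in> V"
  shows "poly_op T p x \<in> V"
  using assms
  by (induction p)
     (auto simp: poly_op_pCons cvec.subspace_0 intro!: cvec.subspace_add cvec.subspace_scale)

text \<open>If p = (X - b) r, then r(T) x is an eigenvector for b unless it vanishes; in that case r
  annihilates \<open>x\<close> and has smaller degree.\<close>

lemma eigenvector_if_annihilated:
  assumes V: "cvec.subspace V" "\<And>y. y \<in> V \<Longrightarrow> T y \<in> V" "x \<in> V"
    and "x \<noteq> 0" "p \<noteq> 0" "poly_op T p x = 0"
  shows "\<exists>b v. v \<in> V \<and> v \<noteq> 0 \<and> T v = b *\<^sub>C v"
  using assms(5,6)
proof (induction "degree p" arbitrary: p)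
  case 0
  then obtain c where "p = [:c:]" using degree_eq_zeroE by metis
  then show ?case using 0 \<open>x \<noteq> 0\<close> by (simp add: poly_op_pCons T.zero)
next
  case (Suc m)
  then have "\<not> constant (poly p)" by (simp add: constant_degree)
  then obtain b where "poly p b = 0" using fundamental_theorem_of_algebra by blast
  then obtain r where r: "p = [:- b, 1:] * r" using poly_eq_0_iff_dvd by (metis dvdE)
  then have rn: "r \<noteq> 0" using Suc.prems(1) by auto
  then have "degree p = Suc (degree r)"
    unfolding r by (subst degree_mult_eq) auto
  then have deg: "m = degree r" using Suc.hyps(2) by simp
  have "T (poly_op T r x) = b *\<^sub>C poly_op T r x"
    using Suc.prems unfolding r poly_op_linear_factor_mult by simp
  then show ?case
    using Suc.hyps(1)[OF deg rn] poly_op_in_subspace[OF V] by blast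
qed

lemma eigenvector_exists:
  assumes V: "cvec.subspace V" "\<And>y. y \<in> V \<Longrightarrow> T y \<in> V" and fin: "cfinite_dim V" and "V \<noteq> {0}"
  obtains b v where "v \<in> V" "v \<noteq> 0" "T v = b *\<^sub>C v"
proof -
  obtain x where x: "x \<in> V" "x \<noteq> 0" using assms(4) cvec.subspace_0[OF V(1)] by blast
  obtain C where C: "finite C" "V \<subseteq> cvec.span C" using fin by (auto simp: cfinite_dim_def)
  let ?O = "\<lambda>k. (\<lambda>i. (T ^^ i) x) ` {..<k}"
  have OV: "(T ^^ i) x \<in> V" for i by (induction i) (auto simp: x V(2))
  \<comment> \<open>An orbit segment longer than the size of a spanning set is dependent, so some
    iterate lies in the span of its predecessors.\<close>
  obtain k where k: "(T ^^ k) x \<in> cvec.span (?O k)"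
  proof (rule ccontr)
    assume "\<not> thesis"
    then have n: "(T ^^ k) x \<notin> cvec.span (?O k)" for k using that by blast
    have "\<not> cvec.dependent (?O k) \<and> card (?O k) = k" for k
    proof (induction k)
      case (Suc k)
      have "?O (Suc k) = insert ((T ^^ k) x) (?O k)" by (simp add: lessThan_Suc)
      then show ?case
        using Suc n[of k] cvec.independent_insertI[OF n[of k]] cvec.span_base[of "(T ^^ k) x" "?O k"]
        by (auto simp: card_insert_if)
    qed (simp add: cvec.independent_empty)
    then show False
      using cvec.independent_span_bound[OF C(1), of "?O (Suc (card C))"] OV C(2) by force
  qed
  \<comment> \<open>Polynomials of degree below \<open>k\<close>: their values at \<open>x\<close>
    form a subspace containing the first \<open>k\<close> iterates. Subtracting one of them from
    \<open>monom 1 k\<close> cannot cancel the leading term, so the annihilating polynomial is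
    nonzero.\<close>
  define P where "P = {p :: complex poly. \<forall>i\<ge>k. coeff p i = 0}"
  have "cvec.subspace ((\<lambda>p. poly_op T p x) ` P)"
  proof (rule cvec.subspaceI)
    show "0 \<in> (\<lambda>p. poly_op T p x) ` P" by (rule image_eqI[of _ _ 0]) (auto simp: P_def)
  next
    fix u v assume "u \<in> (\<lambda>p. poly_op T p x) ` P" "v \<in> (\<lambda>p. poly_op T p x) ` P"
    then obtain p q where "p \<in> P" "q \<in> P" "u = poly_op T p x" "v = poly_op T q x" by blast
    then show "u + v \<in> (\<lambda>p. poly_op T p x) ` P"
      by (intro image_eqI[of _ _ "p + q"]) (auto simp: P_def poly_op_add)
  next
    fix c u assume "u \<in> (\<lambda>p. poly_op T p x) ` P"
    then obtain p where "p \<in> P" "u = poly_op T p x" by blast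
    then show "c *\<^sub>C u \<in> (\<lambda>p. poly_op T p x) ` P"
      by (intro image_eqI[of _ _ "smult c p"]) (auto simp: P_def poly_op_smult)
  qed
  moreover have "?O k \<subseteq> (\<lambda>p. poly_op T p x) ` P"
  proof safe
    fix i assume "i < k"
    then show "(T ^^ i) x \<in> (\<lambda>p. poly_op T p x) ` P"
      by (intro image_eqI[of _ _ "monom 1 i"]) (auto simp: P_def poly_op_monom)
  qed
  ultimately have "cvec.span (?O k) \<subseteq> (\<lambda>p. poly_op T p x) ` P"
    by (metis cvec.span_minimal)
  then obtain p where p: "p \<in> P" "(T ^^ k) x = poly_op T p x" using k by blast
  define q where "q = monom 1 k + smult (- 1) p"
  have "coeff q k = 1" using p(1) by (simp add: q_def P_def)
  then have "q \<noteq> 0" by auto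
  moreover have "poly_op T q x = 0"
    unfolding q_def poly_op_add poly_op_smult poly_op_monom p(2)
    by (simp add: cvec.scale_minus_left)
  ultimately show thesis
    using eigenvector_if_annihilated[OF V x] that by blast
qed

end

section \<open>The Hardy space\<close>

text \<open>A vector of \<open>nat ell2\<close> is identified with the power series that has it as coefficients.\<close>

lemma sum_coord_le:
  assumes "finite F"
  shows "(\<Sum>k\<in>F. (cmod (coord x k))\<^sup>2) \<le> (norm x)\<^sup>2"
proof -
  have "(norm x)\<^sup>2 = (\<Sum>\<^sub>\<infinity>i. (cmod (coord x i))\<^sup>2)"
    by (simp add: norm_ell2_def infsum_nonneg)
  then show ?thesis
    using finite_sum_le_infsum[OF coord_summable[of x] assms] by simp
qed

lemma square_summable_natI:
  fixes f :: "nat \<Rightarrow> complex"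
  assumes "\<And>N. (\<Sum>k<N. (cmod (f k))\<^sup>2) \<le> C"
  shows "(\<lambda>k. (cmod (f k))\<^sup>2) summable_on UNIV"
proof (rule nonneg_bdd_above_summable_on)
  show "bdd_above (sum (\<lambda>k. (cmod (f k))\<^sup>2) ` {F. F \<subseteq> UNIV \<and> finite F})"
  proof (rule bdd_aboveI2)
    fix F :: "nat set" assume F: "F \<in> {F. F \<subseteq> UNIV \<and> finite F}"
    then obtain N where "F \<subseteq> {..<N}" using finite_nat_iff_bounded by auto
    then have "(\<Sum>k\<in>F. (cmod (f k))\<^sup>2) \<le> (\<Sum>k<N. (cmod (f k))\<^sup>2)"
      by (intro sum_mono2) auto
    then show "(\<Sum>k\<in>F. (cmod (f k))\<^sup>2) \<le> C" using assms[of N] by linarith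
  qed
qed simp

lift_definition shift :: "nat ell2 \<Rightarrow> nat ell2" is "\<lambda>f k. case k of 0 \<Rightarrow> 0 | Suc m \<Rightarrow> f m"
proof -
  fix f :: "nat \<Rightarrow> complex"
  let ?g = "\<lambda>k. (cmod (case k of 0 \<Rightarrow> 0 | Suc m \<Rightarrow> f m))\<^sup>2"
  assume "(\<lambda>k. (cmod (f k))\<^sup>2) summable_on UNIV"
  then have "?g summable_on range Suc"
    by (subst summable_on_reindex) (auto simp: o_def)
  then show "?g summable_on UNIV"
    by (rule summable_on_cong_neutral[THEN iffD1, rotated -1]) (auto split: nat.splits)
qed

lift_definition backshift :: "nat ell2 \<Rightarrow> nat ell2" is "\<lambda>f k. f (Suc k)"
proof -
  fix f :: "nat \<Rightarrow> complex"
  assume "(\<lambda>k. (cmod (f k))\<^sup>2) summable_on UNIV"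
  then have "(\<lambda>k. (cmod (f k))\<^sup>2) summable_on range Suc"
    by (rule summable_on_subset_banach) simp
  then show "(\<lambda>k. (cmod (f (Suc k)))\<^sup>2) summable_on UNIV"
    by (subst (asm) summable_on_reindex) (auto simp: o_def)
qed

lemma coord_shift_0 [simp]: "coord (shift x) 0 = 0"
  and coord_shift_Suc [simp]: "coord (shift x) (Suc k) = coord x k"
  and coord_backshift [simp]: "coord (backshift x) k = coord x (Suc k)"
  by (simp_all add: shift.rep_eq backshift.rep_eq)

lemma nat_ell2_eqI:
  "coord x 0 = coord y 0 \<Longrightarrow> (\<And>k. coord x (Suc k) = coord y (Suc k)) \<Longrightarrow> x = y"
  by (rule ell2_eqI) (metis nat.exhaust)

lemma module_hom_shift: "module_hom scaleC scaleC shift"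
  by unfold_locales (auto intro!: nat_ell2_eqI)

lemma module_hom_backshift: "module_hom scaleC scaleC backshift"
  by unfold_locales (auto intro!: ell2_eqI)

interpretation shift: module_hom scaleC scaleC shift by (rule module_hom_shift)
interpretation backshift: module_hom scaleC scaleC backshift by (rule module_hom_backshift)

lemma cinner_shift_left: "cinner (shift x) y = cinner x (backshift y)"
proof -
  have "cinner (shift x) y = (\<Sum>\<^sub>\<infinity>k\<in>range Suc. coord (shift x) k * cnj (coord y k))"
    unfolding cinner_def by (rule infsum_cong_neutral) (auto simp: shift.rep_eq split: nat.splits)
  also have "\<dots> = cinner x (backshift y)"
    by (subst infsum_reindex) (auto simp: o_def cinner_def)
  finally show ?thesis .
qed

lemma backshift_shift [simp]: "backshift (shift x) = x"
  by (rule ell2_eqI) simp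

lemma cinner_shift_shift [simp]: "cinner (shift x) (shift y) = cinner x y"
  by (simp add: cinner_shift_left)

lemma shift_funpow_diff: "(shift ^^ m) (x - y) = (shift ^^ m) x - (shift ^^ m) y"
  and shift_funpow_scale: "(shift ^^ m) (c *\<^sub>C x) = c *\<^sub>C (shift ^^ m) x"
  by (induction m) (simp_all add: shift.diff shift.scale)

lemma norm_shift_funpow [simp]: "norm ((shift ^^ m) x) = norm x"
  by (induction m) (simp_all add: norm_eq_sqrt_inner inner_ell2_def)

subsection \<open>Geometric sequences and difference equations\<close>

text \<open>Convexity of the square with weights |b| and 1 - |b|, at the points |u| and |v| / (1 -
  |b|). The first factor stays below 1, so in a summed recursion the unknown sum can be absorbed on
  the left.\<close>

lemma norm_affine_sq_le:
  fixes b u v :: complex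
  assumes "cmod b < 1"
  shows "(cmod (b * u + v))\<^sup>2 \<le> cmod b * (cmod u)\<^sup>2 + (cmod v)\<^sup>2 / (1 - cmod b)"
proof -
  define r where "r = cmod b"
  have r: "0 \<le> r" "r < 1" using assms by (simp_all add: r_def)
  have "(cmod (b * u + v))\<^sup>2 \<le> (r * cmod u + cmod v)\<^sup>2"
    unfolding r_def by (intro power_mono norm_ge_zero) (metis norm_triangle_ineq norm_mult)
  moreover have "(r * cmod u + cmod v)\<^sup>2 * (1 - r)
      = (r * (cmod u)\<^sup>2 * (1 - r) + (cmod v)\<^sup>2) - r * ((1 - r) * cmod u - cmod v)\<^sup>2"
    by (simp add: power2_eq_square algebra_simps)
  ultimately have "(r * cmod u + cmod v)\<^sup>2 * (1 - r) \<le> r * (cmod u)\<^sup>2 * (1 - r) + (cmod v)\<^sup>2"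
    using r by simp
  then have "(r * cmod u + cmod v)\<^sup>2 \<le> r * (cmod u)\<^sup>2 + (cmod v)\<^sup>2 / (1 - r)"
    using r by (simp add: field_simps)
  then show ?thesis
    using \<open>(cmod (b * u + v))\<^sup>2 \<le> (r * cmod u + cmod v)\<^sup>2\<close> unfolding r_def by linarith
qed

text \<open>Solves \<open>backshift x - b *\<^sub>C x = y\<close> with a prescribed constant term.
  Summing the preceding inequality gives A <= |c|^2 + |b| A + D for every partial sum A, hence a
  uniform bound.\<close>

lemma forward_recursion:
  assumes b: "cmod b < 1"
  obtains x where "coord x 0 = c" "\<And>k. coord x (Suc k) = b * coord x k + coord y k"
proof -
  define f where "f = rec_nat c (\<lambda>k u. b * u + coord y k)"
  have f0: "f 0 = c" and fS: "f (Suc k) = b * f k + coord y k" for k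
    by (simp_all add: f_def)
  define D where "D = (norm y)\<^sup>2 / (1 - cmod b)"
  have "(\<Sum>k<N. (cmod (f k))\<^sup>2) \<le> ((cmod c)\<^sup>2 + D) / (1 - cmod b)" for N
  proof -
    define A where "A = (\<Sum>k<N. (cmod (f k))\<^sup>2)"
    have "A \<le> (\<Sum>k<Suc N. (cmod (f k))\<^sup>2)" by (simp add: A_def)
    also have "\<dots> = (cmod c)\<^sup>2 + (\<Sum>k<N. (cmod (f (Suc k)))\<^sup>2)"
      by (subst sum.lessThan_Suc_shift) (simp add: f0)
    also have "(\<Sum>k<N. (cmod (f (Suc k)))\<^sup>2)
        \<le> (\<Sum>k<N. cmod b * (cmod (f k))\<^sup>2 + (cmod (coord y k))\<^sup>2 / (1 - cmod b))"
      unfolding fS by (intro sum_mono norm_affine_sq_le b)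
    also have "\<dots> = cmod b * A + (\<Sum>k<N. (cmod (coord y k))\<^sup>2) / (1 - cmod b)"
      by (simp add: A_def sum.distrib sum_distrib_left sum_divide_distrib)
    also have "\<dots> \<le> cmod b * A + D"
      unfolding D_def using b by (intro add_left_mono divide_right_mono sum_coord_le) auto
    finally show ?thesis using b by (simp add: A_def field_simps)
  qed
  then have "coord (Abs_ell2 f) = f" by (intro coord_Abs_ell2 square_summable_natI)
  then show thesis using that[of "Abs_ell2 f"] f0 fS by simp
qed

text \<open>Solves \<open>x - b *\<^sub>C backshift x = y\<close> by the Neumann series. The
  constant term of the solution is the value of \<open>y\<close> at \<open>b\<close>, so a zero of
  \<open>y\<close> there becomes visible in \<open>x\<close>.\<close>

lemma backward_recursion:
  assumes b: "cmod b < 1"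
  obtains x where "\<And>k. coord x k = b * coord x (Suc k) + coord y k"
    "coord x 0 = (\<Sum>j. coord y j * b ^ j)"
proof -
  define f where "f k = (\<Sum>j. coord y (k + j) * b ^ j)" for k
  have nle: "norm (coord y i * b ^ j) \<le> norm y * cmod b ^ j" for i j
    by (simp add: norm_mult norm_power mult_right_mono norm_coord_le)
  have geo: "summable (\<lambda>j. norm y * cmod b ^ j)"
    using b by (intro summable_mult summable_geometric) simp
  have sm: "summable (\<lambda>j. coord y (k + j) * b ^ j)" for k
    by (rule summable_comparison_test'[OF geo]) (rule nle)
  have fS: "f k = b * f (Suc k) + coord y k" for k
  proof -
    have "f k = coord y k + (\<Sum>j. coord y (k + Suc j) * b ^ Suc j)"
      unfolding f_def using suminf_split_head[OF sm[of k]] by simp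
    also have "(\<Sum>j. coord y (k + Suc j) * b ^ Suc j) = (\<Sum>j. b * (coord y (Suc k + j) * b ^ j))"
      by (simp add: mult_ac)
    also have "\<dots> = b * f (Suc k)" unfolding f_def by (rule suminf_mult[OF sm])
    finally show ?thesis by simp
  qed
  define M where "M = norm y * (1 / (1 - cmod b))"
  have fM: "cmod (f k) \<le> M" for k
  proof -
    have "cmod (f k) \<le> (\<Sum>j. norm y * cmod b ^ j)"
      unfolding f_def by (rule norm_suminf_le[OF nle geo])
    also have "\<dots> = M"
      unfolding M_def using b by (subst suminf_mult) (auto simp: suminf_geometric summable_geometric)
    finally show ?thesis .
  qed
  define D where "D = (norm y)\<^sup>2 / (1 - cmod b)"
  have "(\<Sum>k<N. (cmod (f k))\<^sup>2) \<le> (cmod b * M\<^sup>2 + D) / (1 - cmod b)" for N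
  proof -
    define A where "A = (\<Sum>k<N. (cmod (f k))\<^sup>2)"
    \<comment> \<open>The recursion refers to the next index, so shifting the sum leaves a boundary
      term at \<open>N\<close>; the uniform bound \<open>M\<close> controls it.\<close>
    have "(\<Sum>k<N. (cmod (f (Suc k)))\<^sup>2) \<le> (\<Sum>k<Suc N. (cmod (f k))\<^sup>2)"
      by (subst sum.lessThan_Suc_shift) simp
    also have "\<dots> \<le> A + M\<^sup>2"
      unfolding A_def using power_mono[OF fM[of N], of 2] by simp
    finally have *: "(\<Sum>k<N. (cmod (f (Suc k)))\<^sup>2) \<le> A + M\<^sup>2" .
    have "A \<le> (\<Sum>k<N. cmod b * (cmod (f (Suc k)))\<^sup>2 + (cmod (coord y k))\<^sup>2 / (1 - cmod b))"
      unfolding A_def by (subst fS) (intro sum_mono norm_affine_sq_le b)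
    also have "\<dots> = cmod b * (\<Sum>k<N. (cmod (f (Suc k)))\<^sup>2)
        + (\<Sum>k<N. (cmod (coord y k))\<^sup>2) / (1 - cmod b)"
      by (simp add: sum.distrib sum_distrib_left sum_divide_distrib)
    also have "\<dots> \<le> cmod b * (A + M\<^sup>2) + D"
      unfolding D_def using b
      by (intro add_mono divide_right_mono sum_coord_le mult_left_mono *) auto
    finally show ?thesis using b by (simp add: A_def field_simps)
  qed
  then have "coord (Abs_ell2 f) = f" by (intro coord_Abs_ell2 square_summable_natI)
  then show thesis using that[of "Abs_ell2 f"] fS by (simp add: f_def)
qed

text \<open>Taylor coefficients of 1 / (1 - b z), the reproducing kernel at \<open>cnj b\<close>;
  meaningful only for |b| < 1, where they are square summable.\<close>

definition geom :: "complex \<Rightarrow> nat ell2" where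
  "geom b = Abs_ell2 (\<lambda>k. b ^ k)"

lemma coord_geom [simp]:
  assumes "cmod b < 1"
  shows "coord (geom b) k = b ^ k"
proof -
  \<comment> \<open>The homogeneous recursion supplies the square summability of the powers of
    \<open>b\<close>.\<close>
  obtain x where x: "coord x 0 = 1" "\<And>k. coord x (Suc k) = b * coord x k + coord 0 k"
    using forward_recursion[OF assms] by metis
  have "coord x k = b ^ k" for k by (induction k) (simp_all add: x)
  then have "coord x = (\<lambda>k. b ^ k)" by blast
  then have "geom b = x" unfolding geom_def by (metis coord_inverse)
  then show ?thesis by (simp add: \<open>coord x k = b ^ k\<close>)
qed

lemma geom_nonzero: "cmod b < 1 \<Longrightarrow> geom b \<noteq> 0"
  using coord_geom[of b 0] coord_zero[of 0] by (metis power_0 zero_neq_one)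

text \<open>The equation makes the coefficients \<open>coord x 0 * b ^ k\<close>; for |b| >= 1 none
  is smaller in modulus than the first, contradicting square summability.\<close>

lemma eigenvector_backshift:
  assumes "backshift x = b *\<^sub>C x" "x \<noteq> 0"
  shows "cmod b < 1" "x = coord x 0 *\<^sub>C geom b" "coord x 0 \<noteq> 0"
proof -
  have "coord x (Suc k) = b * coord x k" for k
    using arg_cong[OF assms(1), of "\<lambda>y. coord y k"] by simp
  then have c: "coord x k = coord x 0 * b ^ k" for k by (induction k) simp_all
  then show n: "coord x 0 \<noteq> 0"
    using assms(2) by (metis ell2_eqI coord_zero mult_zero_left)
  show b: "cmod b < 1"
  proof (rule ccontr)
    assume "\<not> cmod b < 1"
    then have ge: "(cmod (coord x 0))\<^sup>2 \<le> (cmod (coord x k))\<^sup>2" for k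
      unfolding c[of k] using n
      by (intro power_mono) (auto simp: norm_mult norm_power one_le_power)
    obtain N :: nat where N: "(norm x)\<^sup>2 < of_nat N * (cmod (coord x 0))\<^sup>2"
      using n by (metis ex_less_of_nat_mult zero_less_norm_iff zero_less_power)
    have "of_nat N * (cmod (coord x 0))\<^sup>2 \<le> (\<Sum>k<N. (cmod (coord x k))\<^sup>2)"
      using sum_mono[OF ge, of "{..<N}"] by simp
    also have "\<dots> \<le> (norm x)\<^sup>2" by (rule sum_coord_le) simp
    finally show False using N by simp
  qed
  show "x = coord x 0 *\<^sub>C geom b"
    by (rule ell2_eqI) (simp add: b c[symmetric])
qed

lemma backshift_geom: "cmod b < 1 \<Longrightarrow> backshift (geom b) = b *\<^sub>C geom b"
  by (rule ell2_eqI) simp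

lemma module_hom_backshift_diff: "module_hom scaleC scaleC (\<lambda>y. backshift y - b *\<^sub>C y)"
  by unfold_locales (auto intro!: ell2_eqI simp: algebra_simps)

lemma backshift_diff_ker:
  assumes "cmod b < 1"
  shows "backshift y - b *\<^sub>C y = 0 \<longleftrightarrow> y \<in> cvec.span {geom b}"
proof
  assume "backshift y - b *\<^sub>C y = 0"
  then have "backshift y = b *\<^sub>C y" by simp
  then show "y \<in> cvec.span {geom b}"
    using eigenvector_backshift(2)[of y b] by (cases "y = 0") (auto simp: cvec.span_zero cvec.span_singleton)
next
  assume "y \<in> cvec.span {geom b}"
  then obtain c where "y = c *\<^sub>C geom b" by (auto simp: cvec.span_singleton)
  then show "backshift y - b *\<^sub>C y = 0"
    by (simp add: backshift.scale backshift_geom[OF assms] mult.commute)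
qed

lemma backshift_diff_surj:
  assumes "cmod b < 1"
  shows "surj (\<lambda>y. backshift y - b *\<^sub>C y)"
  unfolding surj_def
proof
  fix y
  obtain x where "coord x 0 = 0" "\<And>k. coord x (Suc k) = b * coord x k + coord y k"
    using forward_recursion[OF assms] by metis
  then have "y = backshift x - b *\<^sub>C x" by (intro ell2_eqI) simp
  then show "\<exists>x. y = backshift x - b *\<^sub>C x" by blast
qed

subsection \<open>Point evaluation\<close>

text \<open>The value at \<open>z\<close> is expressed by the reproducing kernel.\<close>

definition eval_hardy :: "nat ell2 \<Rightarrow> complex \<Rightarrow> complex" where
  "eval_hardy x z = cinner x (geom (cnj z))"

lemma eval_hardy_sums:
  assumes "cmod z < 1"
  shows "(\<lambda>k. coord x k * z ^ k) sums eval_hardy x z"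
proof -
  have "((\<lambda>k. coord x k * cnj (coord (geom (cnj z)) k)) has_sum eval_hardy x z) UNIV"
    unfolding eval_hardy_def cinner_def by (rule has_sum_infsum[OF cinner_summable])
  then show ?thesis using has_sum_imp_sums assms by (fastforce simp: o_def)
qed

lemma eval_hardy_diff: "eval_hardy (x - y) z = eval_hardy x z - eval_hardy y z"
  and eval_hardy_scaleC: "eval_hardy (c *\<^sub>C x) z = c * eval_hardy x z"
  by (simp_all add: eval_hardy_def cinner_simps)

lemma eval_hardy_shift:
  assumes "cmod z < 1"
  shows "eval_hardy (shift x) z = z * eval_hardy x z"
  using assms by (simp add: eval_hardy_def cinner_shift_left backshift_geom cinner_simps)

lemma eval_hardy_ket: "cmod z < 1 \<Longrightarrow> eval_hardy (ket k) z = z ^ k"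
  by (simp add: eval_hardy_def cinner_ket_left)

text \<open>Convergence at 1/2 makes both radii positive, so the identity theorem for power series
  applies.\<close>

lemma eval_hardy_eqD:
  assumes eq: "\<And>z. cmod z < 1 \<Longrightarrow> eval_hardy x z = eval_hardy y z"
  shows "x = y"
proof -
  have ev: "eval_fps (Abs_fps (coord u)) z = eval_hardy u z" if "cmod z < 1" for u z
    using sums_unique[OF eval_hardy_sums[OF that, of u]] by (simp add: eval_fps_def)
  have rad: "fps_conv_radius (Abs_fps (coord u)) > 0" for u
  proof -
    have "summable (\<lambda>k. coord u k * (1 / 2) ^ k)"
      using eval_hardy_sums[of "1 / 2" u] by (auto simp: sums_iff)
    then have "ereal (norm (1 / 2 :: complex)) \<le> conv_radius (coord u)"
      by (rule conv_radius_geI)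
    then show ?thesis
      unfolding fps_conv_radius_def by (auto intro: less_le_trans[rotated])
  qed
  have "eventually (\<lambda>z :: complex. z \<in> ball 0 1) (nhds 0)"
    by (intro eventually_nhds_in_open) auto
  then have "eventually (\<lambda>z. eval_fps (Abs_fps (coord x)) z = eval_fps (Abs_fps (coord y)) z) (nhds 0)"
    by (rule eventually_mono) (simp add: ev eq)
  then have "Abs_fps (coord x) = Abs_fps (coord y)"
    by (rule eval_fps_eqD[OF rad rad])
  then show ?thesis by (simp add: Abs_fps_inject coord_inject)
qed

section \<open>Model spaces\<close>

text \<open>For inner \<open>x\<close> this is the orthogonal complement of x H^2; testing against
  the shift orbit replaces multiplication by \<open>x\<close>.\<close>

definition model_space :: "nat ell2 \<Rightarrow> nat ell2 set" where
  "model_space x = {y. \<forall>m. cinner ((shift ^^ m) x) y = 0}"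

lemma subspace_model_space: "cvec.subspace (model_space x)"
  by (rule cvec.subspaceI) (auto simp: model_space_def cinner_simps)

lemma backshift_model_space:
  assumes "y \<in> model_space x"
  shows "backshift y \<in> model_space x"
proof -
  have "cinner ((shift ^^ m) x) (backshift y) = cinner ((shift ^^ Suc m) x) y" for m
    by (simp add: cinner_shift_left)
  then show ?thesis
    using assms unfolding model_space_def mem_Collect_eq by metis
qed

text \<open>The relation says \<open>\<xi> = b\<^sub>a \<eta>\<close> for the Blaschke factor \<open>b\<^sub>a(z) = (z - a) / (1 - cnj a z)\<close>.\<close>

definition blaschke_mult :: "complex \<Rightarrow> nat ell2 \<Rightarrow> nat ell2 \<Rightarrow> bool" where
  "blaschke_mult a \<eta> \<xi> \<longleftrightarrow> \<xi> - cnj a *\<^sub>C shift \<xi> = shift \<eta> - a *\<^sub>C \<eta>"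

lemma eval_hardy_blaschke_mult:
  assumes "blaschke_mult a \<eta> \<xi>" "cmod a < 1" "cmod z < 1"
  shows "eval_hardy \<xi> z = (z - a) / (1 - cnj a * z) * eval_hardy \<eta> z"
proof -
  have "cmod (cnj a * z) < 1"
    using assms mult_strict_mono[of "cmod a" 1 "cmod z" 1] by (simp add: norm_mult)
  then have nz: "1 - cnj a * z \<noteq> 0" by auto
  have "eval_hardy (\<xi> - cnj a *\<^sub>C shift \<xi>) z = eval_hardy (shift \<eta> - a *\<^sub>C \<eta>) z"
    using assms(1) by (simp add: blaschke_mult_def)
  then have "(1 - cnj a * z) * eval_hardy \<xi> z = (z - a) * eval_hardy \<eta> z"
    by (simp add: eval_hardy_diff eval_hardy_scaleC eval_hardy_shift assms algebra_simps)
  then show ?thesis using nz by (simp add: field_simps)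
qed

lemma blaschke_mult_exists:
  assumes "cmod a < 1"
  obtains \<xi> where "blaschke_mult a \<eta> \<xi>"
proof -
  define y where "y = shift \<eta> - a *\<^sub>C \<eta>"
  \<comment> \<open>The coefficients of (1 - cnj a S) \<xi> = y, solved upwards from the constant
    term.\<close>
  obtain \<xi> where "coord \<xi> 0 = coord y 0"
    "\<And>k. coord \<xi> (Suc k) = cnj a * coord \<xi> k + coord (backshift y) k"
    using forward_recursion[of "cnj a"] assms by (metis complex_mod_cnj)
  then have "\<xi> - cnj a *\<^sub>C shift \<xi> = y" by (intro nat_ell2_eqI) simp_all
  then show thesis using that unfolding blaschke_mult_def y_def by blast
qed

text \<open>With y = (1 - cnj a S) \<xi>, the equation to solve is (S - a) \<eta> = y. The backward
  solution \<open>u\<close> has constant term y(a) = 0, so \<open>u = shift (backshift u)\<close>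
  and \<open>backshift u\<close> is the quotient.\<close>

lemma blaschke_mult_divide:
  assumes a: "cmod a < 1" and root: "eval_hardy \<xi> a = 0"
  obtains \<eta> where "blaschke_mult a \<eta> \<xi>"
proof -
  define y where "y = \<xi> - cnj a *\<^sub>C shift \<xi>"
  have y0: "eval_hardy y a = 0"
    by (simp add: y_def eval_hardy_diff eval_hardy_scaleC eval_hardy_shift a root)
  obtain u where u: "\<And>k. coord u k = a * coord u (Suc k) + coord y k"
    "coord u 0 = (\<Sum>j. coord y j * a ^ j)"
    using backward_recursion[OF a] by metis
  have "coord u 0 = 0" using u(2) y0 eval_hardy_sums[OF a, of y] by (simp add: sums_iff)
  then have "shift (backshift u) - a *\<^sub>C backshift u = y"
  proof (intro nat_ell2_eqI)
    fix k
    show "coord (shift (backshift u) - a *\<^sub>C backshift u) (Suc k) = coord y (Suc k)"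
      using u(1)[of "Suc k"] by simp
  qed (use u(1)[of 0] in \<open>simp add: neg_eq_iff_add_eq_0\<close>)
  then show thesis using that unfolding blaschke_mult_def y_def by metis
qed

text \<open>Moving \<open>backshift\<close> and the scalar to the left argument turns membership on
  the right into \<open>c m = cnj a * c (Suc m)\<close>, where
  \<open>c m = cinner ((shift ^^ m) \<xi>) y\<close>. Iterated, this gives
  \<open>c m = cnj a ^ k * c (m + k)\<close>; as \<open>c\<close> is bounded and |a| < 1, it
  vanishes.\<close>

lemma model_space_blaschke_mult:
  assumes rel: "blaschke_mult a \<eta> \<xi>" and a: "cmod a < 1"
  shows "model_space \<xi> = (\<lambda>y. backshift y - cnj a *\<^sub>C y) -` model_space \<eta>"
proof -
  have "y \<in> model_space \<xi> \<longleftrightarrow> backshift y - cnj a *\<^sub>C y \<in> model_space \<eta>" for y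
  proof -
    define c where "c m = cinner ((shift ^^ m) \<xi>) y" for m
    have e: "cinner ((shift ^^ m) \<eta>) (backshift y - cnj a *\<^sub>C y) = c m - cnj a * c (Suc m)" for m
    proof -
      have "cinner ((shift ^^ m) \<eta>) (backshift y - cnj a *\<^sub>C y)
          = cinner ((shift ^^ m) (shift \<eta> - a *\<^sub>C \<eta>)) y"
        by (simp add: cinner_simps shift_funpow_diff shift_funpow_scale cinner_shift_left
            flip: funpow_swap1)
      also have "shift \<eta> - a *\<^sub>C \<eta> = \<xi> - cnj a *\<^sub>C shift \<xi>"
        using rel by (simp add: blaschke_mult_def)
      also have "cinner ((shift ^^ m) (\<xi> - cnj a *\<^sub>C shift \<xi>)) y = c m - cnj a * c (Suc m)"
        by (simp add: c_def cinner_simps shift_funpow_diff shift_funpow_scale flip: funpow_swap1)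
      finally show ?thesis .
    qed
    have "c m = 0" if "\<And>m. c m - cnj a * c (Suc m) = 0" for m
    proof -
      have S: "c m = cnj a * c (Suc m)" for m using that[of m] by simp
      have "c m = cnj a ^ k * c (m + k)" for k
        by (induction k) (simp_all add: S[of "m + _"])
      then have "cmod (c m) \<le> cmod a ^ k * (norm \<xi> * norm y)" for k
        using norm_cinner_le[of "(shift ^^ (m + k)) \<xi>" y]
        by (metis c_def complex_mod_cnj mult_left_mono norm_ge_zero norm_mult norm_power
            norm_shift_funpow zero_le_power)
      moreover have "(\<lambda>k. cmod a ^ k * (norm \<xi> * norm y)) \<longlonglongrightarrow> 0 * (norm \<xi> * norm y)"
        using a by (intro tendsto_mult LIMSEQ_power_zero tendsto_const) simp
      ultimately have "cmod (c m) \<le> 0"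
        by (intro LIMSEQ_le_const[of _ 0]) auto
      then show ?thesis by simp
    qed
    then show ?thesis unfolding model_space_def mem_Collect_eq e by (metis c_def diff_0_right mult_zero_right)
  qed
  then show ?thesis by auto
qed

lemma has_cdim_model_space_blaschke_mult:
  assumes "blaschke_mult a \<eta> \<xi>" "cmod a < 1" "has_cdim (model_space \<eta>) d"
  shows "has_cdim (model_space \<xi>) (Suc d)"
  unfolding model_space_blaschke_mult[OF assms(1,2)]
proof (rule has_cdim_vimage)
  show "backshift x - cnj a *\<^sub>C x = 0 \<longleftrightarrow> x \<in> cvec.span {geom (cnj a)}" for x
    using assms(2) by (intro backshift_diff_ker) simp
qed (use assms in \<open>auto intro!: module_hom_backshift_diff backshift_diff_surj geom_nonzero\<close>)

lemma model_space_const: "c \<noteq> 0 \<Longrightarrow> model_space (c *\<^sub>C ket 0) = {0}"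
proof -
  assume "c \<noteq> 0"
  have "(shift ^^ m) (ket 0) = ket m" for m
    by (induction m) (auto intro!: nat_ell2_eqI)
  then show ?thesis using \<open>c \<noteq> 0\<close>
    by (auto simp: model_space_def shift_funpow_scale cinner_simps cinner_ket_left intro: ell2_eqI)
qed

section \<open>Finite Blaschke products and the dimension of their model spaces\<close>

definition blaschke :: "complex \<Rightarrow> (nat \<Rightarrow> complex) \<Rightarrow> nat \<Rightarrow> complex \<Rightarrow> complex" where
  "blaschke l a d z = l * (\<Prod>j=1..d. (z - a j) / (1 - cnj (a j) * z))"

text \<open>A vector with these values is built one factor at a time, so that the dimension is
  counted along the way; uniqueness of the power series then transfers the count to any vector with
  the same values.\<close>

lemma blaschke_realisation:
  assumes "l \<noteq> 0" "\<forall>j\<in>{1..d}. cmod (a j) < 1"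
  shows "\<exists>x. (\<forall>z. cmod z < 1 \<longrightarrow> eval_hardy x z = blaschke l a d z) \<and> has_cdim (model_space x) d"
  using assms(2)
proof (induction d)
  case 0
  show ?case
    by (rule exI[of _ "l *\<^sub>C ket 0"])
       (simp add: eval_hardy_scaleC eval_hardy_ket blaschke_def model_space_const assms has_cdim_0)
next
  case (Suc d)
  then obtain x where x: "\<And>z. cmod z < 1 \<Longrightarrow> eval_hardy x z = blaschke l a d z"
    "has_cdim (model_space x) d" by auto
  have a: "cmod (a (Suc d)) < 1" using Suc.prems by simp
  obtain y where y: "blaschke_mult (a (Suc d)) x y" using blaschke_mult_exists[OF a] by blast
  show ?case
    by (rule exI[of _ y])
       (simp add: eval_hardy_blaschke_mult[OF y a] x has_cdim_model_space_blaschke_mult[OF y a]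
         blaschke_def)
qed

lemma has_cdim_model_space_blaschke:
  assumes "l \<noteq> 0" "\<forall>j\<in>{1..d}. cmod (a j) < 1"
    and "\<And>z. cmod z < 1 \<Longrightarrow> eval_hardy x z = blaschke l a d z"
  shows "has_cdim (model_space x) d"
  using blaschke_realisation[OF assms(1,2)] eval_hardy_eqD[of x] assms(3) by metis

text \<open>\<open>x\<close> generates an orthonormal sequence under the shift exactly if it is an inner function.\<close>

definition inner_vector :: "nat ell2 \<Rightarrow> bool" where
  "inner_vector x \<longleftrightarrow> (\<forall>m. cinner ((shift ^^ m) x) x = (if m = 0 then 1 else 0))"

text \<open>
  The autocorrelations of \<open>\<eta>\<close> and \<open>\<xi>\<close> satisfy the same three-term recurrence, and their
  difference \<open>h\<close> is bounded, so \<open>\<bar>h\<bar> (1 + \<bar>a\<bar>\<^sup>2) \<le> 2 \<bar>a\<bar> sup \<bar>h\<bar>\<close>, which forces \<open>h = 0\<close>.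
\<close>

lemma inner_vector_blaschke_mult:
  assumes rel: "blaschke_mult a \<eta> \<xi>" and a: "cmod a < 1" and \<xi>: "inner_vector \<xi>"
  shows "inner_vector \<eta>"
proof -
  define G where "G m = cinner ((shift ^^ m) \<eta>) \<eta>" for m
  define F where "F m = cinner ((shift ^^ m) \<xi>) \<xi>" for m
  define h where "h m = G m - F m" for m
  define q where "q = 1 + a * cnj a"
  have eq: "shift \<eta> - a *\<^sub>C \<eta> = \<xi> - cnj a *\<^sub>C shift \<xi>"
    using rel by (simp add: blaschke_mult_def)
  have swap: "(shift ^^ m) (shift x) = shift ((shift ^^ m) x)" for m x
    by (simp add: funpow_swap1)
  have cG: "cinner \<eta> (shift \<eta>) = cnj (G 1)" and cF: "cinner \<xi> (shift \<xi>) = cnj (F 1)"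
    by (simp_all add: G_def F_def flip: cinner_commute)
  have LS: "cinner ((shift ^^ Suc m) (shift \<eta> - a *\<^sub>C \<eta>)) (shift \<eta> - a *\<^sub>C \<eta>)
      = q * G (Suc m) - cnj a * G (Suc (Suc m)) - a * G m" for m
    by (simp add: shift_funpow_diff shift_funpow_scale shift.diff shift.scale swap cinner_simps
        G_def q_def algebra_simps)
  have RS: "cinner ((shift ^^ Suc m) (\<xi> - cnj a *\<^sub>C shift \<xi>)) (\<xi> - cnj a *\<^sub>C shift \<xi>)
      = q * F (Suc m) - cnj a * F (Suc (Suc m)) - a * F m" for m
    by (simp add: shift_funpow_diff shift_funpow_scale shift.diff shift.scale swap cinner_simps
        F_def q_def algebra_simps)
  have L0: "cinner (shift \<eta> - a *\<^sub>C \<eta>) (shift \<eta> - a *\<^sub>C \<eta>) = q * G 0 - cnj a * G 1 - a * cnj (G 1)"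
    unfolding cG[symmetric] by (simp add: cinner_simps G_def q_def algebra_simps)
  have R0: "cinner (\<xi> - cnj a *\<^sub>C shift \<xi>) (\<xi> - cnj a *\<^sub>C shift \<xi>)
      = q * F 0 - cnj a * F 1 - a * cnj (F 1)"
    unfolding cF[symmetric] by (simp add: cinner_simps F_def q_def algebra_simps)
  have hS: "q * h (Suc m) = cnj a * h (Suc (Suc m)) + a * h m" for m
    using trans[OF LS[of m, unfolded eq, symmetric] RS[of m]] unfolding h_def
    by (simp add: algebra_simps)
  have h0: "q * h 0 = cnj a * h 1 + a * cnj (h 1)"
    using trans[OF L0[unfolded eq, symmetric] R0] unfolding h_def by (simp add: algebra_simps)
  define r where "r = cmod a"
  have q: "q = complex_of_real (1 + r\<^sup>2)"
    unfolding q_def r_def by (simp add: complex_norm_square del: of_real_power)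
  define s where "s = (SUP m. cmod (h m))"
  have "cmod (h m) \<le> norm \<eta> * norm \<eta> + norm \<xi> * norm \<xi>" for m
    unfolding h_def G_def F_def
    using norm_triangle_ineq4 norm_cinner_le norm_shift_funpow by (metis add_mono order_trans)
  then have "bdd_above (range (\<lambda>m. cmod (h m)))" by (rule bdd_aboveI2)
  then have hs: "cmod (h m) \<le> s" for m unfolding s_def by (rule cSUP_upper[rotated]) simp
  have bound: "(1 + r\<^sup>2) * cmod (h m) \<le> 2 * r * s" for m
  proof -
    \<comment> \<open>Both neighbours of \<open>h m\<close> have modulus at most \<open>s\<close>;
      for \<open>m = 0\<close> the neighbour of index -1 is \<open>cnj (h 1)\<close>.\<close>
    obtain u v where uv: "q * h m = cnj a * u + a * v" "cmod u \<le> s" "cmod v \<le> s"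
      using hS h0 hs by (cases m) (metis complex_mod_cnj)+
    have "(1 + r\<^sup>2) * cmod (h m) = cmod (q * h m)" by (simp add: q norm_mult del: of_real_add of_real_power)
    also have "\<dots> \<le> r * cmod u + r * cmod v"
      unfolding uv(1) r_def by (metis complex_mod_cnj norm_mult norm_triangle_ineq)
    also have "\<dots> \<le> r * s + r * s"
      by (intro add_mono mult_left_mono uv) (simp_all add: r_def)
    finally show ?thesis by simp
  qed
  have "(1 + r\<^sup>2) * s \<le> 2 * r * s"
  proof -
    have pos: "1 + r\<^sup>2 > 0" by (simp add: add_pos_nonneg)
    have "s \<le> 2 * r * s / (1 + r\<^sup>2)"
      unfolding s_def using bound pos
      by (intro cSUP_least) (auto simp: pos_le_divide_eq mult.commute s_def)
    then show ?thesis using pos by (simp add: pos_le_divide_eq mult.commute)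
  qed
  then have "(1 - r)\<^sup>2 * s \<le> 0" by (simp add: power2_eq_square algebra_simps)
  then have "s \<le> 0" using a unfolding r_def by (simp add: mult_le_0_iff)
  then have "h m = 0" for m using hs[of m] by (metis norm_le_zero_iff order_trans)
  then have "G m = F m" for m by (simp add: h_def)
  then show ?thesis using \<xi> by (simp add: inner_vector_def G_def F_def)
qed

lemma blaschke_if_has_cdim_model_space:
  assumes "inner_vector x" "has_cdim (model_space x) d"
  shows "\<exists>l a. cmod l = 1 \<and> (\<forall>j\<in>{1..d}. cmod (a j) < 1)
    \<and> (\<forall>z. cmod z < 1 \<longrightarrow> eval_hardy x z = blaschke l a d z)"
  using assms
proof (induction d arbitrary: x)
  case 0
  \<comment> \<open>Autocorrelations of positive index vanish for an inner vector, which puts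
    \<open>backshift x\<close> into the trivial model space.\<close>
  have "cinner ((shift ^^ m) x) (backshift x) = cinner ((shift ^^ Suc m) x) x" for m
    by (simp add: cinner_shift_left)
  then have "backshift x \<in> model_space x"
    using 0(1) unfolding model_space_def inner_vector_def mem_Collect_eq by (metis nat.distinct(1))
  then have "backshift x = 0" using 0(2) by (simp add: has_cdim_0)
  then have "coord x (Suc k) = 0" for k by (metis coord_backshift coord_zero)
  then have c: "x = coord x 0 *\<^sub>C ket 0"
    by (intro nat_ell2_eqI) simp_all
  have "cinner x x = 1" using 0(1) by (metis funpow_0 inner_vector_def)
  then have "norm x = 1" by (simp add: norm_eq_sqrt_inner inner_ell2_def)
  then have "cmod (coord x 0) = 1" using arg_cong[OF c, of norm] by (simp add: norm_scaleC)
  then show ?case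
    using arg_cong[OF c, of eval_hardy]
    by (intro exI[of _ "coord x 0"] exI[of _ "\<lambda>_. 0"])
       (auto simp: blaschke_def eval_hardy_scaleC eval_hardy_ket)
next
  case (Suc d)
  have "model_space x \<noteq> {0}"
    using Suc.prems(2) has_cdim_0 has_cdim_dim by (metis nat.distinct(1))
  then obtain b v where v: "v \<in> model_space x" "v \<noteq> 0" "backshift v = b *\<^sub>C v"
    using eigenvector_exists[OF module_hom_backshift subspace_model_space backshift_model_space
        has_cdim_imp_cfinite_dim[OF Suc.prems(2)]] by blast
  define a0 where "a0 = cnj b"
  have b: "cmod a0 < 1" using eigenvector_backshift(1)[OF v(3,2)] by (simp add: a0_def)
  have "cinner x v = 0" using v(1) unfolding model_space_def by (metis (mono_tags) funpow_0 mem_Collect_eq)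
  \<comment> \<open>\<open>v\<close> is a nonzero multiple of \<open>geom b\<close>, the kernel at
    \<open>a0 = cnj b\<close>, so its orthogonality to \<open>x\<close> says that \<open>x\<close>
    vanishes at \<open>a0\<close>.\<close>
  then have "eval_hardy x a0 = 0"
    using eigenvector_backshift(2,3)[OF v(3,2)]
    by (metis a0_def cinner_scaleC_right complex_cnj_cnj complex_cnj_zero_iff eval_hardy_def mult_eq_0_iff)
  then obtain y where y: "blaschke_mult a0 y x" using blaschke_mult_divide[OF b] by blast
  have inn: "inner_vector y" by (rule inner_vector_blaschke_mult[OF y b Suc.prems(1)])
  \<comment> \<open>By surjectivity the new model space is an image of the old one, hence
    finite-dimensional. Its dimension \<open>k\<close> is then found from the increase by one in
    passing from \<open>y\<close> back to \<open>x\<close>.\<close>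
  have "model_space y = (\<lambda>y. backshift y - cnj a0 *\<^sub>C y) ` model_space x"
    unfolding model_space_blaschke_mult[OF y b]
    using b by (intro surj_image_vimage_eq[symmetric] backshift_diff_surj) simp
  then have "cfinite_dim (model_space y)"
    using cfinite_dim_linear_image[OF module_hom_backshift_diff has_cdim_imp_cfinite_dim[OF Suc.prems(2)]]
    by simp
  then obtain k where k: "has_cdim (model_space y) k"
    using cfinite_dim_imp_has_cdim[OF subspace_model_space] by blast
  have "Suc k = Suc d"
    using has_cdim_model_space_blaschke_mult[OF y b k] Suc.prems(2) has_cdim_dim by metis
  then obtain l a where la: "cmod l = 1" "\<forall>j\<in>{1..d}. cmod (a j) < 1"
    "\<And>z. cmod z < 1 \<Longrightarrow> eval_hardy y z = blaschke l a d z"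
    using Suc.IH[OF inn] k by auto
  define a' where "a' = a(Suc d := a0)"
  have "(\<Prod>j=1..d. (z - a' j) / (1 - cnj (a' j) * z)) = (\<Prod>j=1..d. (z - a j) / (1 - cnj (a j) * z))" for z
    by (rule prod.cong) (auto simp: a'_def)
  then have "blaschke l a' (Suc d) z = (z - a0) / (1 - cnj a0 * z) * blaschke l a d z" for z
    by (simp add: blaschke_def a'_def)
  then have "eval_hardy x z = blaschke l a' (Suc d) z" if "cmod z < 1" for z
    by (simp add: eval_hardy_blaschke_mult[OF y b that] la(3)[OF that])
  moreover have "\<forall>j\<in>{1..Suc d}. cmod (a' j) < 1" using la(2) b by (auto simp: a'_def)
  ultimately show ?case using la(1) by blast
qed

section \<open>Compactness and finite dimension\<close>

text \<open>The real span of \<open>B\<close> and its multiples by \<i> is closed under \<i>, so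
  real orthogonal bases become available for complex spans.\<close>

lemma cspan_subset_span: "cvec.span B \<subseteq> span (B \<union> (\<lambda>x. \<i> *\<^sub>C x) ` B)"
proof (rule cvec.span_minimal)
  let ?S = "span (B \<union> (\<lambda>x. \<i> *\<^sub>C x) ` B)"
  have i: "\<i> *\<^sub>C x \<in> ?S" if "x \<in> ?S" for x
    using that
  proof (induction rule: span_induct)
    case base
    have "\<i> *\<^sub>C (r *\<^sub>R x) = r *\<^sub>R (\<i> *\<^sub>C x)" for r and x :: "'a ell2"
      by (rule ell2_eqI) simp
    then show ?case
      by (intro subspaceI)
         (simp_all add: span_zero cvec.scale_right_distrib span_add span_scale)
  next
    case (step x)
    have ii: "\<i> *\<^sub>C \<i> *\<^sub>C y = - y" for y :: "'a ell2" by (rule ell2_eqI) (simp flip: mult.assoc)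
    from step consider "x \<in> B" | y where "y \<in> B" "x = \<i> *\<^sub>C y" by blast
    then show ?case by cases (auto simp: ii simp del: cvec.scale_scale intro: span_base span_neg)
  qed
  have "c *\<^sub>C x = Re c *\<^sub>R x + Im c *\<^sub>R (\<i> *\<^sub>C x)" for c and x :: "'a ell2"
    by (rule ell2_eqI) (simp add: complex_eq_iff)
  then have "c *\<^sub>C x \<in> ?S" if "x \<in> ?S" for c x
    using that i by (metis span_add span_scale)
  then show "cvec.subspace ?S"
    by (intro cvec.subspaceI) (simp_all add: span_zero span_add)
qed (auto intro: span_base)

lemma span_subset_cspan: "span B \<subseteq> cvec.span B"
  by (rule span_minimal)
     (auto intro!: subspaceI simp: cvec.span_zero cvec.span_add scaleR_ell2_def cvec.span_scale
       intro: cvec.span_base)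

lemma csubspace_imp_subspace: "cvec.subspace V \<Longrightarrow> subspace V"
  by (auto intro!: subspaceI simp: cvec.subspace_0 cvec.subspace_add scaleR_ell2_def cvec.subspace_scale)

text \<open>The set is a Minkowski sum of segments, and sums of compact sets are compact.\<close>

lemma compact_box_combinations:
  fixes C :: "'a::real_normed_vector set"
  assumes "finite C"
  shows "compact {\<Sum>c\<in>C. f c *\<^sub>R c |f. \<forall>c\<in>C. \<bar>f c\<bar> \<le> M}"
  using assms
proof (induction C rule: finite_induct)
  case (insert c C)
  let ?B = "\<lambda>C. {\<Sum>c\<in>C. f c *\<^sub>R c |f. \<forall>c\<in>C. \<bar>f c\<bar> \<le> M}"
  have "compact ((\<lambda>t. t *\<^sub>R c) ` {-M..M})"
    by (intro compact_continuous_image continuous_intros) simp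
  then have "compact {x + y |x y. x \<in> (\<lambda>t. t *\<^sub>R c) ` {-M..M} \<and> y \<in> ?B C}"
    using insert.IH by (rule compact_sums)
  also have "{x + y |x y. x \<in> (\<lambda>t. t *\<^sub>R c) ` {-M..M} \<and> y \<in> ?B C} = ?B (insert c C)"
  proof (intro equalityI subsetI)
    fix u assume "u \<in> {x + y |x y. x \<in> (\<lambda>t. t *\<^sub>R c) ` {-M..M} \<and> y \<in> ?B C}"
    then obtain t f where "t \<in> {-M..M}" and tf: "\<forall>c\<in>C. \<bar>f c\<bar> \<le> M" "u = t *\<^sub>R c + (\<Sum>c\<in>C. f c *\<^sub>R c)"
      by blast
    have "(\<Sum>d\<in>C. (f(c := t)) d *\<^sub>R d) = (\<Sum>c\<in>C. f c *\<^sub>R c)"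
      using insert.hyps by (intro sum.cong) auto
    then have "u = (\<Sum>d\<in>insert c C. (f(c := t)) d *\<^sub>R d)"
      using insert.hyps tf(2) by simp
    moreover have "\<forall>d\<in>insert c C. \<bar>(f(c := t)) d\<bar> \<le> M"
      using tf(1) \<open>t \<in> {-M..M}\<close> by auto
    ultimately show "u \<in> ?B (insert c C)" by blast
  next
    fix u assume "u \<in> ?B (insert c C)"
    then obtain f where f: "\<forall>d\<in>insert c C. \<bar>f d\<bar> \<le> M" "u = (\<Sum>d\<in>insert c C. f d *\<^sub>R d)"
      by blast
    then have "u = f c *\<^sub>R c + (\<Sum>d\<in>C. f d *\<^sub>R d)" using insert.hyps by simp
    moreover have "f c *\<^sub>R c \<in> (\<lambda>t. t *\<^sub>R c) ` {-M..M}"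
      using f(1) by (intro imageI) (simp add: abs_le_iff)
    moreover have "(\<Sum>d\<in>C. f d *\<^sub>R d) \<in> ?B C" using f(1) by blast
    ultimately show "u \<in> {x + y |x y. x \<in> (\<lambda>t. t *\<^sub>R c) ` {-M..M} \<and> y \<in> ?B C}" by blast
  qed
  finally show ?case .
qed simp

lemma compact_closure_if_cfinite_dim:
  assumes "cfinite_dim V" "A \<subseteq> V" and bd: "\<And>x. x \<in> A \<Longrightarrow> norm x \<le> K"
  shows "compact (closure A)"
proof -
  obtain B where B: "finite B" "V \<subseteq> cvec.span B" using assms(1) by (auto simp: cfinite_dim_def)
  obtain C0 where C0: "finite C0" "span C0 = span (B \<union> (\<lambda>x. \<i> *\<^sub>C x) ` B)" "pairwise orthogonal C0"
    using basis_orthogonal[of "B \<union> (\<lambda>x. \<i> *\<^sub>C x) ` B"] B(1) by auto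
  define C where "C = C0 - {0}"
  have C: "finite C" "pairwise orthogonal C" "0 \<notin> C" "A \<subseteq> span C"
    using C0 assms(2) B(2) cspan_subset_span[of B]
    by (auto simp: C_def span_delete_0 intro: pairwise_subset)
  \<comment> \<open>Cauchy-Schwarz and orthogonality bound the coefficient at \<open>c\<close> by
    |K| / norm c; the sum is a common bound, defined also for empty \<open>C\<close>.\<close>
  define M where "M = (\<Sum>c\<in>C. \<bar>K\<bar> / norm c)"
  let ?B = "{\<Sum>c\<in>C. f c *\<^sub>R c |f. \<forall>c\<in>C. \<bar>f c\<bar> \<le> M}"
  have "A \<subseteq> ?B"
  proof
    fix x assume x: "x \<in> A"
    then obtain f where f: "x = (\<Sum>c\<in>C. f c *\<^sub>R c)" using C(4) span_finite[OF C(1)] by blast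
    have "\<bar>f c\<bar> \<le> M" if c: "c \<in> C" for c
    proof -
      have "inner x c = (\<Sum>d\<in>C. f d * inner d c)" by (simp add: f inner_sum_left)
      also have "\<dots> = (\<Sum>d\<in>C. if d = c then f c * inner c c else 0)"
        using C(2) c by (intro sum.cong) (auto simp: pairwise_def orthogonal_def)
      also have "\<dots> = f c * (norm c)\<^sup>2" using C(1) c by (simp add: power2_norm_eq_inner)
      finally have "\<bar>f c\<bar> * (norm c)\<^sup>2 = \<bar>inner x c\<bar>" by (simp add: abs_mult)
      also have "\<dots> \<le> norm x * norm c" by (rule Cauchy_Schwarz_ineq2)
      also have "\<dots> \<le> \<bar>K\<bar> * norm c" using bd[OF x] by (intro mult_right_mono) auto
      finally have "\<bar>f c\<bar> \<le> \<bar>K\<bar> / norm c"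
        using C(3) c by (cases "c = 0") (auto simp: field_simps power2_eq_square)
      also have "\<dots> \<le> M" unfolding M_def using C(1) c by (intro member_le_sum) auto
      finally show ?thesis .
    qed
    then show "x \<in> ?B" using f by blast
  qed
  then show ?thesis
    using compact_box_combinations[OF C(1), of M] bounded_subset compact_imp_bounded
    by (metis (no_types, lifting) closed_closure closure_minimal compact_Int_closed compact_imp_closed inf.absorb_iff2)
qed

text \<open>Riesz's argument in inner product form: a unit vector orthogonal to a finite net has
  distance at least 1 from each of its points, so a net of open unit balls must span
  \<open>V\<close>.\<close>

lemma cfinite_dim_if_compact_unit_ball:
  assumes V: "cvec.subspace V" and K: "compact K" "V \<inter> cball 0 1 \<subseteq> K" "K \<subseteq> V"
  shows "cfinite_dim V"
proof -
  have RV: "subspace V" using V by (rule csubspace_imp_subspace)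
  obtain k where k: "finite k" "k \<subseteq> K" "K \<subseteq> (\<Union>y\<in>k. ball y 1)"
    using seq_compact_imp_totally_bounded[OF compact_imp_seq_compact[OF K(1)],
        rule_format, OF zero_less_one] that by blast
  obtain C where C: "finite C" "span C = span k" "pairwise orthogonal C"
    using basis_orthogonal[OF k(1)] by blast
  have CV: "C \<subseteq> V"
    using C(2) k(2) K(3) RV by (metis order_trans span_minimal span_superset)
  have "V \<subseteq> span C"
  proof
    fix v assume v: "v \<in> V"
    define w where "w = v - (\<Sum>c\<in>C. (inner v c / inner c c) *\<^sub>R c)"
    have wV: "w \<in> V"
      unfolding w_def using CV RV v
      by (intro subspace_diff subspace_sum subspace_scale) auto
    have orth: "inner w c = 0" if c: "c \<in> C" for c
    proof -
      have "(\<Sum>d\<in>C. inner v d / inner d d * inner d c)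
          = (\<Sum>d\<in>C. if d = c then inner v c / inner c c * inner c c else 0)"
        using C(3) c by (intro sum.cong) (auto simp: pairwise_def orthogonal_def)
      also have "\<dots> = inner v c" using C(1) c by auto
      finally show ?thesis by (simp add: w_def inner_diff_left inner_sum_left)
    qed
    have "w = 0"
    proof (rule ccontr)
      assume "w \<noteq> 0"
      define u where "u = (1 / norm w) *\<^sub>R w"
      have "norm u = 1" using \<open>w \<noteq> 0\<close> by (simp add: u_def)
      moreover have "u \<in> V" unfolding u_def using wV RV by (intro subspace_scale)
      ultimately obtain y where y: "y \<in> k" "dist y u < 1" using K(2) k(3) by force
      have "y \<in> span C" using y(1) C(2) by (simp add: span_base)
      then have "orthogonal u y"
        by (rule orthogonal_to_span) (simp add: orthogonal_def u_def orth)
      then have "(norm (u - y))\<^sup>2 = 1 + (norm y)\<^sup>2"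
        using \<open>norm u = 1\<close> norm_add_Pythagorean[of u "- y"] by (simp add: orthogonal_clauses)
      then have "1\<^sup>2 \<le> (norm (u - y))\<^sup>2" by simp
      then have "1 \<le> norm (u - y)" by (rule power2_le_imp_le) simp
      then show False using y(2) by (simp add: dist_norm norm_minus_commute)
    qed
    then have "v = (\<Sum>c\<in>C. (inner v c / inner c c) *\<^sub>R c)" by (simp add: w_def)
    then show "v \<in> span C" by (metis (no_types, lifting) span_base span_scale span_sum)
  qed
  then show ?thesis using C(1) span_subset_cspan unfolding cfinite_dim_def by blast
qed

section \<open>Isometries of the Fock space\<close>

lemma subspace_fock: "cvec.subspace (fock n)"
  by (rule cvec.subspaceI) (auto intro: fock_zero fock_add fock_scaleC)

lemma bounded_linear_coord: "bounded_linear (\<lambda>x. coord x i)"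
  using bounded_linear_cinner_left[of "ket i"] by (simp add: cinner_ket_right)

lemma closed_fock: "closed (fock n)"
proof -
  have "fock n = (\<Inter>\<mu>\<in>- words n. {x. coord x \<mu> = 0})" by (auto simp: fock_def)
  moreover have "closed {x. coord x \<mu> = 0}" for \<mu> :: "nat list"
    by (intro closed_Collect_eq linear_continuous_on bounded_linear_coord continuous_on_const)
  ultimately show ?thesis by auto
qed

lemma cinner_eq_0_commute: "cinner x y = 0 \<longleftrightarrow> cinner y x = 0"
  by (metis cinner_commute complex_cnj_zero_iff)

text \<open>The kernel of the adjoint, phrased by orthogonality to the range to bypass the definite
  description in \<open>adjoint_on\<close>.\<close>

definition cokernel :: "nat \<Rightarrow> (nat list ell2 \<Rightarrow> nat list ell2) \<Rightarrow> nat list ell2 set" where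
  "cokernel n T = {y \<in> fock n. \<forall>x\<in>fock n. cinner (T x) y = 0}"

lemma subspace_cokernel: "cvec.subspace (cokernel n T)"
  by (rule cvec.subspaceI)
     (auto simp: cokernel_def cinner_simps intro: fock_zero fock_add fock_scaleC)

lemma closed_cokernel: "closed (cokernel n T)"
proof -
  have "cokernel n T = fock n \<inter> (\<Inter>x\<in>fock n. {y. cinner y (T x) = 0})"
    unfolding cokernel_def by (auto simp: cinner_eq_0_commute)
  moreover have "closed {y. cinner y z = 0}" for z :: "nat list ell2"
    by (intro closed_Collect_eq linear_continuous_on bounded_linear_cinner_left continuous_on_const)
  ultimately show ?thesis using closed_fock by (simp add: closed_Int closed_INT)
qed

section \<open>Adjoint and defect projection of an isometry\<close>

context
  fixes n :: nat and T :: "nat list ell2 \<Rightarrow> nat list ell2"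
  assumes iso: "isometry_on (fock n) T"
begin

lemma isometry_fock: "x \<in> fock n \<Longrightarrow> T x \<in> fock n"
  and isometry_add: "x \<in> fock n \<Longrightarrow> y \<in> fock n \<Longrightarrow> T (x + y) = T x + T y"
  and isometry_scaleC: "x \<in> fock n \<Longrightarrow> T (c *\<^sub>C x) = c *\<^sub>C T x"
  and isometry_norm: "x \<in> fock n \<Longrightarrow> norm (T x) = norm x"
  using iso by (auto simp: isometry_on_def clinear_on_def)

lemma isometry_diff: "x \<in> fock n \<Longrightarrow> y \<in> fock n \<Longrightarrow> T (x - y) = T x - T y"
  using isometry_add[of x "(- 1) *\<^sub>C y"] isometry_scaleC[of y "-1"] fock_scaleC[of y n "-1"]
  by (simp add: cvec.scale_minus_left)

lemma isometry_zero: "T 0 = 0"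
  using isometry_norm[OF fock_zero] by simp

lemma isometry_sum:
  "(\<And>i. i \<in> F \<Longrightarrow> f i \<in> fock n) \<Longrightarrow> T (\<Sum>i\<in>F. f i) = (\<Sum>i\<in>F. T (f i))"
proof (induction F rule: infinite_finite_induct)
  case (insert i F)
  then show ?case using cvec.subspace_sum[OF subspace_fock, of F f n] by (simp add: isometry_add)
qed (simp_all add: isometry_zero)

lemma isometry_cinner:
  assumes "x \<in> fock n" "y \<in> fock n"
  shows "cinner (T x) (T y) = cinner x y"
  using assms
  by (intro cinner_eq_if_norm_eq)
     (metis isometry_add isometry_scaleC isometry_norm fock_add fock_scaleC)+

text \<open>For the test vector X with coordinates <y, T e_\<mu>> on \<open>F\<close> one has <y, T
  X> = |X|^2; as T is isometric, Cauchy-Schwarz gives |X| <= |y|.\<close>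

lemma bessel:
  assumes "finite F" "F \<subseteq> words n"
  shows "(\<Sum>\<mu>\<in>F. (cmod (cinner y (T (ket \<mu>))))\<^sup>2) \<le> (norm y)\<^sup>2"
proof -
  define c where "c \<mu> = cinner y (T (ket \<mu>))" for \<mu>
  define X where "X = (\<Sum>\<mu>\<in>F. c \<mu> *\<^sub>C ket \<mu>)"
  define Q where "Q = (\<Sum>\<mu>\<in>F. (cmod (c \<mu>))\<^sup>2)"
  have XH: "X \<in> fock n"
    unfolding X_def using assms
    by (intro cvec.subspace_sum[OF subspace_fock]) (auto intro: fock_scaleC fock_ket)
  have "T X = (\<Sum>\<mu>\<in>F. c \<mu> *\<^sub>C T (ket \<mu>))"
    unfolding X_def using assms(2)
    by (subst isometry_sum) (auto intro!: sum.cong isometry_scaleC fock_scaleC fock_ket)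
  then have "cinner y (T X) = (\<Sum>\<mu>\<in>F. cnj (c \<mu>) * c \<mu>)"
    by (simp add: cinner_sum_right cinner_scaleC_right c_def)
  also have "\<dots> = complex_of_real Q"
    by (simp add: Q_def complex_norm_square mult.commute del: of_real_power)
  finally have yX: "cinner y (T X) = complex_of_real Q" .
  have cX: "coord X \<mu> = (if \<mu> \<in> F then c \<mu> else 0)" for \<mu>
    unfolding X_def coord_sum using assms(1) by (simp add: if_distrib[of "(*) _"] cong: if_cong)
  have "cinner X X = (\<Sum>\<mu>\<in>F. c \<mu> * cnj (coord X \<mu>))"
    by (subst (1) X_def) (simp add: cinner_sum_left cinner_scaleC_left cinner_ket_left)
  also have "\<dots> = complex_of_real Q"
    by (simp add: cX Q_def complex_norm_square del: of_real_power)
  finally have XX: "(norm X)\<^sup>2 = Q" unfolding cinner_self by (simp only: of_real_eq_iff)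
  have Q0: "0 \<le> Q" unfolding Q_def by (rule sum_nonneg) simp
  have "(norm X)\<^sup>2 \<le> norm y * norm X"
    using norm_cinner_le[of y "T X"] Q0 by (simp add: yX XX isometry_norm[OF XH])
  then have "norm X \<le> norm y"
    by (cases "X = 0") (auto simp: power2_eq_square)
  then show ?thesis
    using XX unfolding Q_def c_def by (metis norm_ge_zero power_mono)
qed

text \<open>The coordinates are forced to be <y, T e_\<mu>>, and Bessel makes them square summable.
  The identity holds on finite combinations of basis vectors and passes to the limit by
  continuity.\<close>

lemma adjoint_exists:
  obtains z where "z \<in> fock n" "\<And>x. x \<in> fock n \<Longrightarrow> cinner (T x) y = cinner x z"
proof -
  define f where "f \<mu> = (if \<mu> \<in> words n then cinner y (T (ket \<mu>)) else 0)" for \<mu>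
  have "(\<lambda>\<mu>. (cmod (f \<mu>))\<^sup>2) summable_on UNIV"
  proof (rule nonneg_bdd_above_summable_on)
    show "bdd_above (sum (\<lambda>\<mu>. (cmod (f \<mu>))\<^sup>2) ` {F. F \<subseteq> UNIV \<and> finite F})"
    proof (rule bdd_aboveI2)
      fix F :: "nat list set" assume "F \<in> {F. F \<subseteq> UNIV \<and> finite F}"
      then have F: "finite F" by simp
      have "(\<Sum>\<mu>\<in>F. (cmod (f \<mu>))\<^sup>2) = (\<Sum>\<mu>\<in>F \<inter> words n. (cmod (cinner y (T (ket \<mu>))))\<^sup>2)"
        using F by (intro sum.mono_neutral_cong_right) (auto simp: f_def)
      also have "\<dots> \<le> (norm y)\<^sup>2" by (rule bessel) (use F in auto)
      finally show "(\<Sum>\<mu>\<in>F. (cmod (f \<mu>))\<^sup>2) \<le> (norm y)\<^sup>2" .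
    qed
  qed simp
  then have cz: "coord (Abs_ell2 f) = f" by (rule coord_Abs_ell2)
  define z where "z = Abs_ell2 f"
  have zH: "z \<in> fock n" by (simp add: fock_def z_def cz f_def)
  have "cinner (T x) y = cinner x z" if x: "x \<in> fock n" for x
  proof -
    define \<phi> where "\<phi> u = cinner (T u) y - cinner u z" for u
    let ?S = "\<lambda>F. \<Sum>\<mu>\<in>F. coord x \<mu> *\<^sub>C ket \<mu>"
    have S: "?S F \<in> fock n" "\<phi> (?S F) = 0" if "finite F" "F \<subseteq> words n" for F
    proof -
      show "?S F \<in> fock n"
        using that by (intro cvec.subspace_sum[OF subspace_fock]) (auto intro: fock_scaleC fock_ket)
      have "T (?S F) = (\<Sum>\<mu>\<in>F. coord x \<mu> *\<^sub>C T (ket \<mu>))"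
        using that(2)
        by (subst isometry_sum) (auto intro!: sum.cong isometry_scaleC fock_scaleC fock_ket)
      moreover have "cinner (T (ket \<mu>)) y = cinner (ket \<mu>) z" if "\<mu> \<in> words n" for \<mu>
        using that cinner_commute[of "T (ket \<mu>)" y] by (simp add: cinner_ket_left z_def cz f_def)
      ultimately show "\<phi> (?S F) = 0"
        using that(2) by (auto simp: \<phi>_def cinner_sum_left cinner_scaleC_left intro!: sum.cong)
    qed
    have bound: "cmod (\<phi> x) \<le> norm (?S F - x) * (norm y + norm z)" if "finite F" "F \<subseteq> words n" for F
    proof -
      let ?u = "?S F - x"
      have uH: "?u \<in> fock n" using S(1)[OF that] x cvec.subspace_diff[OF subspace_fock] by blast
      have "\<phi> ?u = - \<phi> x"
        using S[OF that] x by (simp add: \<phi>_def isometry_diff cinner_diff_left)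
      then have "cmod (\<phi> x) = cmod (cinner (T ?u) y - cinner ?u z)"
        by (metis \<phi>_def norm_minus_cancel)
      also have "\<dots> \<le> cmod (cinner (T ?u) y) + cmod (cinner ?u z)" by (rule norm_triangle_ineq4)
      also have "\<dots> \<le> norm ?u * norm y + norm ?u * norm z"
        using norm_cinner_le[of "T ?u" y] isometry_norm[OF uH] by (intro add_mono norm_cinner_le) simp
      finally show ?thesis by (simp add: distrib_left)
    qed
    have "((\<lambda>\<mu>. coord x \<mu> *\<^sub>C ket \<mu>) has_sum x) (words n)"
      using x by (intro has_sum_ket) (auto simp: fock_def)
    then have "((\<lambda>F. norm (?S F - x) * (norm y + norm z)) \<longlongrightarrow> 0 * (norm y + norm z))
        (finite_subsets_at_top (words n))"
      unfolding has_sum_def by (intro tendsto_mult tendsto_const tendsto_norm_zero LIM_zero)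
    then have "cmod (\<phi> x) \<le> 0 * (norm y + norm z)"
      by (rule tendsto_lowerbound)
         (auto intro!: eventually_finite_subsets_at_top_weakI bound)
    then show ?thesis by (simp add: \<phi>_def)
  qed
  then show thesis using that zH by blast
qed

lemma adjoint_on_eqI:
  assumes "z \<in> fock n" "\<And>x. x \<in> fock n \<Longrightarrow> cinner (T x) y = cinner x z"
  shows "adjoint_on (fock n) T y = z"
  unfolding adjoint_on_def
proof (rule the_equality)
  fix z' assume z': "z' \<in> fock n \<and> (\<forall>x\<in>fock n. cinner (T x) y = cinner x z')"
  then have "z' - z \<in> fock n" using assms(1) cvec.subspace_diff[OF subspace_fock] by blast
  then have "cinner (z' - z) (z' - z) = 0"
    using z' assms(2) by (metis cinner_diff_right diff_self)
  then show "z' = z" by (simp add: cinner_self)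
qed (use assms in auto)

lemma adjoint_on_fock: "adjoint_on (fock n) T y \<in> fock n"
  and cinner_adjoint_on: "x \<in> fock n \<Longrightarrow> cinner (T x) y = cinner x (adjoint_on (fock n) T y)"
  using adjoint_exists adjoint_on_eqI by metis+

lemma norm_adjoint_on_le: "norm (adjoint_on (fock n) T y) \<le> norm y"
proof -
  let ?z = "adjoint_on (fock n) T y"
  have "(norm ?z)\<^sup>2 = cmod (cinner (T ?z) y)"
    by (simp add: cinner_adjoint_on adjoint_on_fock cinner_self del: of_real_power)
  also have "\<dots> \<le> norm ?z * norm y"
    using norm_cinner_le[of "T ?z" y] by (simp add: isometry_norm adjoint_on_fock)
  finally show ?thesis by (cases "?z = 0") (auto simp: power2_eq_square)
qed

lemma kernel_adjoint_on: "kernel_on (fock n) (adjoint_on (fock n) T) = cokernel n T"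
proof -
  have "adjoint_on (fock n) T y = 0 \<longleftrightarrow> (\<forall>x\<in>fock n. cinner (T x) y = 0)" for y
    using adjoint_on_eqI[of 0 y] cinner_adjoint_on[of _ y] by (auto simp: fock_zero cinner_zero_right)
  then show ?thesis by (auto simp: kernel_on_def cokernel_def)
qed

lemma in_cokernelI:
  assumes "y \<in> fock n" "\<And>\<mu>. \<mu> \<in> words n \<Longrightarrow> cinner (T (ket \<mu>)) y = 0"
  shows "y \<in> cokernel n T"
proof -
  have "coord (adjoint_on (fock n) T y) \<mu> = 0" for \<mu>
    using assms(2)[of \<mu>] adjoint_on_fock[of y]
    by (cases "\<mu> \<in> words n") (auto simp: cinner_adjoint_on fock_ket cinner_ket_left fock_def)
  then have "adjoint_on (fock n) T y = 0" by (intro ell2_eqI) simp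
  then show ?thesis using assms(1) by (simp add: kernel_on_def flip: kernel_adjoint_on)
qed

text \<open>On \<open>fock n\<close>, the orthogonal projection onto
  \<open>cokernel n T\<close>.\<close>

definition defect :: "nat list ell2 \<Rightarrow> nat list ell2" where
  "defect x = x - T (adjoint_on (fock n) T x)"

lemma defect_cokernel:
  assumes "x \<in> fock n"
  shows "defect x \<in> cokernel n T"
proof -
  have "cinner (T u) (defect x) = 0" if "u \<in> fock n" for u
    unfolding defect_def cinner_diff_right cinner_adjoint_on[OF that, of x]
    by (simp add: isometry_cinner that adjoint_on_fock)
  moreover have "defect x \<in> fock n"
    unfolding defect_def
    by (intro cvec.subspace_diff[OF subspace_fock] assms isometry_fock adjoint_on_fock)
  ultimately show ?thesis by (simp add: cokernel_def)
qed

lemma defect_id: "x \<in> cokernel n T \<Longrightarrow> defect x = x"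
  by (simp add: defect_def isometry_zero kernel_on_def flip: kernel_adjoint_on)

lemma clinear_on_defect: "clinear_on (fock n) defect"
proof -
  have add: "adjoint_on (fock n) T (x + y) = adjoint_on (fock n) T x + adjoint_on (fock n) T y" for x y
    by (intro adjoint_on_eqI) (auto simp: cinner_add_right cinner_adjoint_on adjoint_on_fock fock_add)
  have scale: "adjoint_on (fock n) T (c *\<^sub>C x) = c *\<^sub>C adjoint_on (fock n) T x" for c x
    by (intro adjoint_on_eqI)
       (auto simp: cinner_scaleC_right cinner_adjoint_on adjoint_on_fock fock_scaleC)
  have "defect x \<in> fock n" if "x \<in> fock n" for x
    using defect_cokernel[OF that] by (simp add: cokernel_def)
  then show ?thesis
    unfolding clinear_on_def
    by (simp add: defect_def add scale isometry_add isometry_scaleC adjoint_on_fock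
        cvec.scale_right_diff_distrib)
qed

lemma norm_defect_le: "norm (defect x) \<le> 2 * norm x"
  using norm_triangle_ineq4[of x "T (adjoint_on (fock n) T x)"] norm_adjoint_on_le[of x]
  by (simp add: defect_def isometry_norm adjoint_on_fock)

text \<open>The projection fixes the unit ball of the cokernel, so compactness makes that ball
  relatively compact; conversely it maps the unit ball to a bounded set in a finite-dimensional
  space.\<close>

lemma compact_defect_iff: "compact_operator_on (fock n) defect \<longleftrightarrow> cfinite_dim (cokernel n T)"
proof
  let ?A = "defect ` (cball 0 1 \<inter> fock n)"
  assume "compact_operator_on (fock n) defect"
  then have "compact (closure ?A)" by (simp add: compact_operator_on_def)
  moreover have "cokernel n T \<inter> cball 0 1 \<subseteq> closure ?A"
  proof
    fix x assume x: "x \<in> cokernel n T \<inter> cball 0 1"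
    then have "x \<in> fock n" by (simp add: cokernel_def)
    then have "x \<in> ?A" using x defect_id[of x] by (metis Int_iff image_eqI)
    then show "x \<in> closure ?A" by (rule subsetD[OF closure_subset])
  qed
  moreover have "closure ?A \<subseteq> cokernel n T"
    using defect_cokernel by (intro closure_minimal closed_cokernel) auto
  ultimately show "cfinite_dim (cokernel n T)"
    by (rule cfinite_dim_if_compact_unit_ball[OF subspace_cokernel])
next
  assume "cfinite_dim (cokernel n T)"
  then have "compact (closure (defect ` (cball 0 1 \<inter> fock n)))"
  proof (rule compact_closure_if_cfinite_dim)
    show "defect ` (cball 0 1 \<inter> fock n) \<subseteq> cokernel n T" using defect_cokernel by auto
    show "norm x \<le> 2" if "x \<in> defect ` (cball 0 1 \<inter> fock n)" for x
      using that norm_defect_le by (force intro: order_trans)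
  qed
  then show "compact_operator_on (fock n) defect"
    by (simp add: compact_operator_on_def clinear_on_defect)
qed

text \<open>\<open>defect\<close> vanishes on the range, and its zeros lie in the range; its
  boundedness carries the vanishing to limits.\<close>

lemma closed_range: "closed (T ` fock n)"
proof -
  have "y \<in> T ` fock n" if "\<And>k. s k \<in> T ` fock n" "s \<longlonglongrightarrow> y" for s y
  proof -
    note range = that(1)
    have "s k \<in> fock n" for k using range[of k] isometry_fock by auto
    then have H: "y \<in> fock n"
      using closed_fock that(2) by (metis closed_sequentially)
    have sH: "s k \<in> fock n" "defect (s k) = 0" for k
    proof -
      obtain x where x: "x \<in> fock n" "s k = T x" using range[of k] by blast
      then have "adjoint_on (fock n) T (s k) = x"
        by (intro adjoint_on_eqI) (auto simp: isometry_cinner)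
      then show "s k \<in> fock n" "defect (s k) = 0" using x by (auto simp: defect_def isometry_fock)
    qed
    have "norm (defect y) \<le> 2 * norm (y - s k)" for k
    proof -
      have m: "y - s k = y + (- 1) *\<^sub>C s k" by (simp add: cvec.scale_minus_left)
      have "defect (y - s k) = defect y + (- 1) *\<^sub>C defect (s k)"
        unfolding m using clinear_on_defect sH(1)[of k] H unfolding clinear_on_def
        by (metis fock_scaleC)
      then show ?thesis using norm_defect_le[of "y - s k"] by (simp add: sH)
    qed
    moreover have "(\<lambda>k. 2 * norm (y - s k)) \<longlonglongrightarrow> 2 * norm (y - y)"
      by (intro tendsto_intros that)
    ultimately have "norm (defect y) \<le> 2 * norm (y - y)"
      by (intro LIMSEQ_le_const[where X = "\<lambda>k. 2 * norm (y - s k)"]) auto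
    then have "y = T (adjoint_on (fock n) T y)" by (simp add: defect_def)
    then show ?thesis using adjoint_on_fock by blast
  qed
  then show ?thesis unfolding closed_sequential_limits by blast
qed

lemma kernel_on_isometry: "kernel_on (fock n) T = {0}"
  using isometry_norm by (force simp: kernel_on_def fock_zero isometry_zero)

lemma fredholm_iff: "fredholm_on (fock n) T \<longleftrightarrow> cfinite_dim (cokernel n T)"
proof -
  have "bounded_clinear_on (fock n) T"
    using iso unfolding bounded_clinear_on_def isometry_on_def by (auto intro: exI[of _ 1])
  moreover have "cfinite_dim {0 :: nat list ell2}" using has_cdim_imp_cfinite_dim has_cdim_0 by blast
  ultimately show ?thesis
    by (simp add: fredholm_on_def closed_range kernel_on_isometry kernel_adjoint_on)
qed

lemma index_isometry: "has_cdim (cokernel n T) d \<Longrightarrow> index_on (fock n) T = - int d"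
  using has_cdim_dim[of "{0 :: nat list ell2}" 0]
  by (simp add: index_on_def kernel_on_isometry kernel_adjoint_on has_cdim_0 has_cdim_dim)

end

section \<open>The odometer map as a multiplication operator\<close>

lemma word_split_first:
  assumes "\<exists>x\<in>set \<mu>. x \<noteq> c"
  obtains r a \<tau> where "\<mu> = replicate r c @ a # \<tau>" "a \<noteq> c"
proof -
  obtain ys a \<tau> where s: "\<mu> = ys @ a # \<tau>" "a \<noteq> c" "\<forall>y\<in>set ys. \<not> y \<noteq> c"
    using split_list_first_prop[OF assms] by blast
  then have "ys = replicate (length ys) c" by (simp add: replicate_eqI)
  then show thesis using that s by metis
qed

lemma word_cases:
  obtains (const) "\<mu> = replicate (length \<mu>) c"
    | (split) r a \<tau> where "\<mu> = replicate r c @ a # \<tau>" "a \<noteq> c"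
  by (metis replicate_eqI word_split_first)

lemma replicate_append_neq_replicate: "a \<noteq> c \<Longrightarrow> replicate r c @ a # \<tau> \<noteq> replicate m c"
  by (metis in_set_conv_decomp in_set_replicate)

lemma odometer_basis_split:
  assumes "a \<noteq> n"
  shows "odometer_basis n \<xi> (replicate r n @ a # \<tau>) = ket (replicate r 1 @ Suc a # \<tau>)"
proof -
  let ?\<mu> = "replicate r n @ a # \<tau>"
  let ?P = "\<lambda>j. j < length ?\<mu> \<and> ?\<mu> ! j \<noteq> n"
  have P: "?P r" using assms by (simp add: nth_append)
  have "(LEAST j. ?P j) = r"
  proof (rule Least_equality)
    show "?P r" by (rule P)
    show "r \<le> j" if "?P j" for j
      using that by (rule contrapos_pp) (simp add: nth_append)
  qed
  moreover have "\<exists>j<length ?\<mu>. ?\<mu> ! j \<noteq> n" using P by blast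
  ultimately show ?thesis
    unfolding odometer_basis_def by (simp add: Let_def nth_append)
qed

lemma odometer_basis_replicate: "odometer_basis n \<xi> (replicate m n) = (creation 1 ^^ m) \<xi>"
proof -
  have "\<not> (\<exists>j<length (replicate m n). replicate m n ! j \<noteq> n)" by simp
  then show ?thesis unfolding odometer_basis_def by (simp only: if_False length_replicate)
qed

text \<open>The inclusion of the Hardy space as \<open>M_perp\<close>, that is, the inverse of \<open>U1\<close>.\<close>

lift_definition embed_ones :: "nat ell2 \<Rightarrow> nat list ell2"
  is "\<lambda>f \<mu>. if \<mu> = replicate (length \<mu>) 1 then f (length \<mu>) else 0"
proof -
  fix f :: "nat \<Rightarrow> complex"
  let ?g = "\<lambda>\<mu> :: nat list. (cmod (if \<mu> = replicate (length \<mu>) 1 then f (length \<mu>) else 0))\<^sup>2"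
  have inj: "inj (\<lambda>p. replicate p (1 :: nat))" by (rule injI) (metis length_replicate)
  assume "(\<lambda>k. (cmod (f k))\<^sup>2) summable_on UNIV"
  then have "?g summable_on range (\<lambda>p. replicate p 1)"
    by (subst summable_on_reindex[OF inj]) (auto simp: o_def)
  then show "?g summable_on UNIV"
    by (rule summable_on_cong_neutral[THEN iffD1, rotated -1]) auto
qed

text \<open>In coefficients, the orthogonal projection onto \<open>M_perp\<close> followed by
  \<open>U1\<close>.\<close>

lift_definition restrict_ones :: "nat list ell2 \<Rightarrow> nat ell2" is "\<lambda>f p. f (replicate p 1)"
proof -
  fix f :: "nat list \<Rightarrow> complex"
  have inj: "inj (\<lambda>p. replicate p (1 :: nat))" by (rule injI) (metis length_replicate)
  assume "(\<lambda>\<mu>. (cmod (f \<mu>))\<^sup>2) summable_on UNIV"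
  then have "(\<lambda>\<mu>. (cmod (f \<mu>))\<^sup>2) summable_on range (\<lambda>p. replicate p 1)"
    by (rule summable_on_subset_banach) simp
  then show "(\<lambda>p. (cmod (f (replicate p 1)))\<^sup>2) summable_on UNIV"
    by (subst (asm) summable_on_reindex[OF inj]) (auto simp: o_def)
qed

lemma coord_embed_ones:
  "coord (embed_ones x) \<mu> = (if \<mu> = replicate (length \<mu>) 1 then coord x (length \<mu>) else 0)"
  by (simp add: embed_ones.rep_eq)

lemma coord_restrict_ones [simp]: "coord (restrict_ones y) p = coord y (replicate p 1)"
  by (simp add: restrict_ones.rep_eq)

lemma coord_embed_ones_replicate [simp]: "coord (embed_ones x) (replicate p (Suc 0)) = coord x p"
  by (simp add: coord_embed_ones)

lemma restrict_embed_ones [simp]: "restrict_ones (embed_ones x) = x"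
  by (rule ell2_eqI) simp

lemma embed_restrict_ones:
  assumes "\<And>\<mu>. \<mu> \<noteq> replicate (length \<mu>) 1 \<Longrightarrow> coord y \<mu> = 0"
  shows "embed_ones (restrict_ones y) = y"
  by (rule ell2_eqI) (use assms in \<open>auto simp: coord_embed_ones\<close>)

lemma module_hom_embed_ones: "module_hom scaleC scaleC embed_ones"
  by unfold_locales (auto intro!: ell2_eqI simp: coord_embed_ones)

lemma inj_embed_ones: "inj embed_ones"
  by (metis injI restrict_embed_ones)

lemma cinner_embed_ones: "cinner (embed_ones x) (embed_ones y) = cinner x y"
proof -
  have inj: "inj (\<lambda>p. replicate p (1 :: nat))" by (rule injI) (metis length_replicate)
  have "cinner (embed_ones x) (embed_ones y)
      = (\<Sum>\<^sub>\<infinity>\<mu>\<in>range (\<lambda>p. replicate p 1). coord (embed_ones x) \<mu> * cnj (coord (embed_ones y) \<mu>))"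
    unfolding cinner_def by (rule infsum_cong_neutral) (auto simp: coord_embed_ones)
  also have "\<dots> = cinner x y"
    by (subst infsum_reindex[OF inj]) (simp add: o_def cinner_def)
  finally show ?thesis .
qed

lemma creation_embed_ones: "creation 1 (embed_ones x) = embed_ones (shift x)"
proof (rule ell2_eqI)
  fix \<mu> :: "nat list"
  show "coord (creation 1 (embed_ones x)) \<mu> = coord (embed_ones (shift x)) \<mu>"
    by (cases \<mu>) (auto simp: creation.rep_eq coord_embed_ones)
qed

lemma creation_funpow_embed_ones: "(creation 1 ^^ m) (embed_ones x) = embed_ones ((shift ^^ m) x)"
  by (induction m) (simp_all add: creation_embed_ones[unfolded One_nat_def])

lemma replicate_words: "a \<in> {1..n} \<Longrightarrow> replicate m a \<in> words n"
  by (auto simp: words_def in_lists_conv_set)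

lemma embed_ones_fock:
  assumes "n \<ge> 1"
  shows "embed_ones x \<in> fock n"
  unfolding fock_def
proof (intro CollectI allI impI)
  fix \<mu> assume "\<mu> \<notin> words n"
  then have "\<mu> \<noteq> replicate (length \<mu>) 1"
    using assms replicate_words[of 1 n "length \<mu>"] by auto
  then show "coord (embed_ones x) \<mu> = 0" unfolding coord_embed_ones by (rule if_not_P)
qed

lemma U1_embed_ones: "cmod z < 1 \<Longrightarrow> U1 (embed_ones x) z = eval_hardy x z"
  using eval_hardy_sums[of z x] by (simp add: U1_def sums_iff)

lemma embed_ones_M_perp: "embed_ones x \<in> M_perp"
proof -
  let ?A = "range (\<lambda>p. replicate p (1 :: nat))"
  let ?S = "\<lambda>F. \<Sum>\<mu>\<in>F. coord (embed_ones x) \<mu> *\<^sub>C ket \<mu>"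
  have "((\<lambda>\<mu>. coord (embed_ones x) \<mu> *\<^sub>C ket \<mu>) has_sum embed_ones x) ?A"
    by (rule has_sum_ket) (auto simp: coord_embed_ones)
  then have lim: "(?S \<longlongrightarrow> embed_ones x) (finite_subsets_at_top ?A)"
    by (simp add: has_sum_def)
  have "?S F \<in> M_perp" if "F \<subseteq> ?A" for F
  proof -
    have "?S F \<in> cvec.span (range (\<lambda>p. ket (replicate p (1 :: nat))))"
      using that by (intro cvec.span_sum cvec.span_scale cvec.span_base) auto
    then show ?thesis unfolding M_perp_def by (rule subsetD[OF closure_subset])
  qed
  then show ?thesis
    by (intro Lim_in_closed_set[OF _ _ _ lim])
       (auto simp: M_perp_def intro!: eventually_finite_subsets_at_top_weakI)
qed

section \<open>Symbol and cokernel of an isometric odometer\<close>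

context
  fixes n :: nat and \<xi> :: "nat list ell2"
  assumes n: "n \<ge> 2" and symbol: "isometric_scalar_symbol n \<xi>"
begin

lemma isometry_odometer: "isometry_on (fock n) (odometer n \<xi>)"
  and symbol_fock: "\<xi> \<in> fock n"
  using symbol by (auto simp: isometric_scalar_symbol_def)

text \<open>The odometer run backwards: leading letters 1 become \<open>n\<close>, and the first
  letter other than 1 is lowered by one. It is then below \<open>n\<close>, so the carry stops
  exactly there.\<close>

lemma ket_in_odometer_range:
  assumes "\<nu> \<in> words n" "\<nu> \<noteq> replicate (length \<nu>) 1"
  obtains \<mu> where "\<mu> \<in> words n" "\<mu> \<noteq> []" "odometer n \<xi> (ket \<mu>) = ket \<nu>"
proof -
  obtain r b \<tau> where \<nu>: "\<nu> = replicate r 1 @ b # \<tau>" "b \<noteq> 1"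
    using assms(2) by (cases \<nu> rule: word_cases[where c = 1]) auto
  have b: "2 \<le> b" "b \<le> n" and \<tau>: "\<tau> \<in> lists {1..n}"
    using assms(1) \<nu> by (auto simp: words_def)
  let ?\<mu> = "replicate r n @ (b - 1) # \<tau>"
  have \<mu>: "?\<mu> \<in> words n" using b n \<tau> by (auto simp: words_def in_lists_conv_set)
  have "odometer n \<xi> (ket ?\<mu>) = ket \<nu>"
    unfolding odometer_ket[OF \<mu>] using b \<nu> by (subst odometer_basis_split) auto
  then show thesis using that[of ?\<mu>] \<mu> by blast
qed

text \<open>A basis vector outside the powers of 1 is the image of some \<open>ket \<mu>\<close>
  with nonempty \<mu>, while \<xi> is the image of \<open>ket []\<close>; the isometry preserves
  their orthogonality.\<close>

lemma symbol_eq_embed_ones: "embed_ones (restrict_ones \<xi>) = \<xi>"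
proof (rule embed_restrict_ones)
  fix \<nu> :: "nat list" assume ne: "\<nu> \<noteq> replicate (length \<nu>) 1"
  show "coord \<xi> \<nu> = 0"
  proof (cases "\<nu> \<in> words n")
    case True
    then obtain \<mu> where \<mu>: "\<mu> \<in> words n" "\<mu> \<noteq> []" "odometer n \<xi> (ket \<mu>) = ket \<nu>"
      using ket_in_odometer_range ne by blast
    have nil: "[] \<in> words n" by (simp add: words_def)
    have "odometer n \<xi> (ket []) = \<xi>"
      using odometer_ket[OF nil] by (simp add: odometer_basis_def)
    then have "coord \<xi> \<nu> = cinner (ket []) (ket \<mu>)"
      using isometry_cinner[OF isometry_odometer fock_ket[OF nil] fock_ket[OF \<mu>(1)]] \<mu>(3)
      by (simp add: cinner_ket_right)
    then show ?thesis using \<mu>(2) by (simp add: cinner_ket_right)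
  qed (use symbol_fock in \<open>simp add: fock_def\<close>)
qed

lemma odometer_ket_replicate:
  "odometer n \<xi> (ket (replicate m n)) = embed_ones ((shift ^^ m) (restrict_ones \<xi>))"
proof -
  have "replicate m n \<in> words n" using n by (intro replicate_words) simp
  then have "odometer n \<xi> (ket (replicate m n)) = (creation 1 ^^ m) (embed_ones (restrict_ones \<xi>))"
    unfolding symbol_eq_embed_ones by (simp only: odometer_ket odometer_basis_replicate)
  then show ?thesis by (simp only: creation_funpow_embed_ones)
qed

text \<open>The words consisting only of \<open>n\<close> are sent to the shift orbit of the symbol,
  which inherits their orthonormality.\<close>

lemma inner_vector_symbol: "inner_vector (restrict_ones \<xi>)"
proof -
  have "cinner ((shift ^^ m) (restrict_ones \<xi>)) ((shift ^^ 0) (restrict_ones \<xi>))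
      = cinner (ket (replicate m n)) (ket (replicate 0 n))" for m
    using n unfolding cinner_embed_ones[symmetric] odometer_ket_replicate[symmetric]
    by (intro isometry_cinner[OF isometry_odometer] fock_ket replicate_words) auto
  then show ?thesis by (simp add: inner_vector_def cinner_ket_right)
qed

lemma cokernel_odometer: "cokernel n (odometer n \<xi>) = embed_ones ` model_space (restrict_ones \<xi>)"
proof (intro equalityI subsetI)
  fix y assume y: "y \<in> cokernel n (odometer n \<xi>)"
  have "embed_ones (restrict_ones y) = y"
  proof (rule embed_restrict_ones)
    fix \<nu> :: "nat list" assume ne: "\<nu> \<noteq> replicate (length \<nu>) 1"
    show "coord y \<nu> = 0"
    proof (cases "\<nu> \<in> words n")
      case True
      then obtain \<mu> where "\<mu> \<in> words n" "odometer n \<xi> (ket \<mu>) = ket \<nu>"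
        using ket_in_odometer_range ne by blast
      then have "cinner (ket \<nu>) y = 0" using y fock_ket by (fastforce simp: cokernel_def)
      then show ?thesis by (simp add: cinner_ket_left)
    qed (use y in \<open>simp add: cokernel_def fock_def\<close>)
  qed
  moreover have "cinner ((shift ^^ m) (restrict_ones \<xi>)) (restrict_ones y) = 0" for m
  proof -
    have "ket (replicate m n) \<in> fock n" using n by (intro fock_ket replicate_words) simp
    then have "cinner (odometer n \<xi> (ket (replicate m n))) y = 0"
      using y by (simp add: cokernel_def)
    then show ?thesis
      using cinner_embed_ones[of _ "restrict_ones y"] by (simp add: odometer_ket_replicate \<open>embed_ones (restrict_ones y) = y\<close>)
  qed
  ultimately show "y \<in> embed_ones ` model_space (restrict_ones \<xi>)"
    by (intro image_eqI[of _ _ "restrict_ones y"]) (simp_all add: model_space_def)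
next
  fix y assume "y \<in> embed_ones ` model_space (restrict_ones \<xi>)"
  then obtain u where u: "u \<in> model_space (restrict_ones \<xi>)" "y = embed_ones u" by blast
  show "y \<in> cokernel n (odometer n \<xi>)"
  proof (rule in_cokernelI[OF isometry_odometer])
    show "y \<in> fock n" using n by (simp add: u(2) embed_ones_fock)
    fix \<mu> assume \<mu>: "\<mu> \<in> words n"
    show "cinner (odometer n \<xi> (ket \<mu>)) y = 0"
    proof (cases \<mu> rule: word_cases[where c = n])
      case const
      then have "odometer n \<xi> (ket \<mu>) = embed_ones ((shift ^^ length \<mu>) (restrict_ones \<xi>))"
        using odometer_ket_replicate[of "length \<mu>"] by simp
      then show ?thesis using u by (simp add: cinner_embed_ones model_space_def)
    next
      \<comment> \<open>Letters are positive, so \<open>Suc a\<close> differs from 1: the image is a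
        basis vector on which \<open>y\<close>, supported on powers of 1, has coordinate 0.\<close>
      case (split r a \<tau>)
      then have "a \<noteq> 0" using \<mu> by (auto simp: words_def)
      then have "replicate r 1 @ Suc a # \<tau> \<noteq> replicate k 1" for k
        by (intro replicate_append_neq_replicate) simp
      then have "coord y (replicate r 1 @ Suc a # \<tau>) = 0"
        unfolding u(2) coord_embed_ones by (rule if_not_P)
      moreover have "odometer n \<xi> (ket \<mu>) = ket (replicate r 1 @ Suc a # \<tau>)"
        unfolding odometer_ket[OF \<mu>] by (simp add: split odometer_basis_split)
      ultimately show ?thesis by (simp add: cinner_ket_left)
    qed
  qed
qed

lemma has_cdim_cokernel_odometer:
  "has_cdim (model_space (restrict_ones \<xi>)) d \<Longrightarrow> has_cdim (cokernel n (odometer n \<xi>)) d"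
  unfolding cokernel_odometer
  by (rule has_cdim_linear_image[OF module_hom_embed_ones inj_embed_ones])

text \<open>Degree and dimension agree for the same \<open>d\<close>, which yields the index along
  with the equivalence.\<close>

lemma finite_blaschke_symbol_iff:
  "finite_blaschke_symbol n \<xi> d \<longleftrightarrow> has_cdim (model_space (restrict_ones \<xi>)) d"
proof -
  have eval: "U1 \<xi> z = eval_hardy (restrict_ones \<xi>) z" if "cmod z < 1" for z
    using U1_embed_ones[OF that, of "restrict_ones \<xi>"] by (simp add: symbol_eq_embed_ones)
  have "\<xi> \<in> M_perp" using embed_ones_M_perp[of "restrict_ones \<xi>"] by (simp add: symbol_eq_embed_ones)
  then have "finite_blaschke_symbol n \<xi> d \<longleftrightarrow>
      (\<exists>l a. cmod l = 1 \<and> (\<forall>j\<in>{1..d}. cmod (a j) < 1)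
        \<and> (\<forall>z. cmod z < 1 \<longrightarrow> eval_hardy (restrict_ones \<xi>) z = blaschke l a d z))"
    using symbol by (simp add: finite_blaschke_symbol_def blaschke_def eval Ball_def)
  also have "\<dots> \<longleftrightarrow> has_cdim (model_space (restrict_ones \<xi>)) d"
  proof
    assume "\<exists>l a. cmod l = 1 \<and> (\<forall>j\<in>{1..d}. cmod (a j) < 1)
        \<and> (\<forall>z. cmod z < 1 \<longrightarrow> eval_hardy (restrict_ones \<xi>) z = blaschke l a d z)"
    then obtain l a where la: "cmod l = 1" "\<forall>j\<in>{1..d}. cmod (a j) < 1"
      "\<And>z. cmod z < 1 \<Longrightarrow> eval_hardy (restrict_ones \<xi>) z = blaschke l a d z" by blast
    from la(1) have "l \<noteq> 0" by auto
    then show "has_cdim (model_space (restrict_ones \<xi>)) d"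
      using la(2,3) by (rule has_cdim_model_space_blaschke)
  qed (rule blaschke_if_has_cdim_model_space[OF inner_vector_symbol])
  finally show ?thesis .
qed

lemma cfinite_dim_cokernel_odometer_iff:
  "cfinite_dim (cokernel n (odometer n \<xi>)) \<longleftrightarrow> (\<exists>d. finite_blaschke_symbol n \<xi> d)"
proof
  assume "cfinite_dim (cokernel n (odometer n \<xi>))"
  then have "cfinite_dim (model_space (restrict_ones \<xi>))"
    unfolding cokernel_odometer
    by (rule cfinite_dim_inj_image[OF module_hom_embed_ones inj_embed_ones subspace_model_space])
  then show "\<exists>d. finite_blaschke_symbol n \<xi> d"
    using cfinite_dim_imp_has_cdim[OF subspace_model_space] finite_blaschke_symbol_iff by metis
next
  assume "\<exists>d. finite_blaschke_symbol n \<xi> d"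
  then show "cfinite_dim (cokernel n (odometer n \<xi>))"
    using finite_blaschke_symbol_iff has_cdim_cokernel_odometer has_cdim_imp_cfinite_dim by blast
qed

end

theorem theorem4p3:
  fixes n :: nat and \<xi> :: "nat list ell2"
  assumes "n \<ge> 2"
    and "isometric_scalar_symbol n \<xi>"
  shows "(fredholm_on (fock n) (odometer n \<xi>) \<longleftrightarrow>
            compact_operator_on (fock n)
              (\<lambda>x. x - odometer n \<xi> (adjoint_on (fock n) (odometer n \<xi>) x)))
       \<and> (compact_operator_on (fock n)
              (\<lambda>x. x - odometer n \<xi> (adjoint_on (fock n) (odometer n \<xi>) x)) \<longleftrightarrow>
            (\<exists>d. finite_blaschke_symbol n \<xi> d))
       \<and> (\<forall>d. finite_blaschke_symbol n \<xi> d \<longrightarrow> index_on (fock n) (odometer n \<xi>) = - int d)"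
proof -
  note iso = isometry_odometer[OF assms]
  have "defect n (odometer n \<xi>) = (\<lambda>x. x - odometer n \<xi> (adjoint_on (fock n) (odometer n \<xi>) x))"
    by (simp add: defect_def[OF iso] fun_eq_iff)
  then show ?thesis
    using fredholm_iff[OF iso] compact_defect_iff[OF iso] cfinite_dim_cokernel_odometer_iff[OF assms]
      index_isometry[OF iso] finite_blaschke_symbol_iff[OF assms] has_cdim_cokernel_odometer[OF assms]
    by simp
qed

end
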